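(* Let $\vartheta$ be an expanding primitive random substitution on a finite alphabet $\mathcal A$. Let $\ell\in\mathbb N$, let $v\in\mathcal L_\vartheta^\ell$ be a $\vartheta$-legal word of length $\ell$, and let $(I_n)_{n\in\mathbb N}$, $I_n=[a_n,b_n]$ with $a_n\le b_n$ in $\mathbb Z$, be a sequence of integer intervals whose lengths $d_n=b_n-a_n+1$ are strictly increasing in $n$. Then for $\mu_\vartheta$-almost every $y\in\mathbb X_\vartheta$ the frequency of $v$ in $y$ with respect to $(I_n)_{n\in\mathbb N}$ is well defined and given by $R_v^{(\ell)}$, that is, $$\lim_{n\to\infty}\frac{|y_{[a_n,b_n]}|_v}{d_n}=R_v^{(\ell)}.$$
   Context: Words. $\mathcal A$ is a finite alphabet, $\mathcal A^+=\bigcup_{n\ge 1}\mathcal A^n$ is the set of non-empty finite words, $|u|$ is the length of $u$, $u_{[k,m]}=u_k\cdots u_m$, and $|u|_v$ is the number of (possibly overlapping) occurrences of $v$ as a subword of $u$; $v\triangleleft u$ means $|u|_v\ge 1$. Random substitution. A random substitution $\vartheta$ on $\mathcal A$ is determined by a map $a\mapsto P^\vartheta_a$ assigning to each $a\in\mathcal A$ a finitely supported probability measure on $\mathcal A^+$. The transition kernel is $P(u_1\cdots u_m,v)=\sum_{v^1\cdots v^m=v}P^\vartheta_{u_1}(v^1)\cdots P^\vartheta_{u_m}(v^m)$ (sum over $v^1,\dots,v^m\in\mathcal A^+$ with concatenation $v$). For $u=u_1\cdots u_m\in\mathcal A^+$, $(\vartheta^n(u))_{n\ge 0}$ is the Markov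 chain on $\mathcal A^+$ with $\vartheta^0(u)=u$ and transition kernel $P$; it is realised on one probability space so that $\vartheta^n(u)=\vartheta^n(u_1)\cdots\vartheta^n(u_m)$ pointwise for all $n$, where $(\vartheta^n(u_1))_n,\dots,(\vartheta^n(u_m))_n$ are independent Markov chains with kernel $P$ started at the letters $u_1,\dots,u_m$. The mean substitution matrix is $(M_\vartheta)_{ab}=\mathbb E|\vartheta(b)|_a$, $a,b\in\mathcal A$. $\vartheta$ is primitive if $M_\vartheta$ is a primitive matrix; a primitive $\vartheta$ is expanding if $\mathbb P[|\vartheta(a)|>1]>0$ for some $a\in\mathcal A$. Language and subshift. $\mathcal L_\vartheta=\{u\in\mathcal A^+: u\triangleleft v \text{ for some } v \text{ with } \mathbb P[\vartheta^n(a)=v]>0 \text{ for some } n\in\mathbb N, a\in\mathcal A\}$, $\mathcal L_\vartheta^\ell$ is the set of elements of $\mathcal L_\vartheta$ of length $\ell$ (legal words), and $\mathbb X_\vartheta=\{x\in\mathcal A^{\mathbb Z}: x_{[k,m]}\in\mathcal L_\vartheta\text{ for all }k\le m\}$. Induced matrix. For $\ell\in\mathbb N$ let $\mathcal A_\ell=\mathcal L_\vartheta^\ell$. For $u=u_1\cdots u_\ell\in\mathcal A_\ell$ define the random word over the alphabet $\mathcal A_\ell$, $\vartheta_\ell(u)=(\vartheta(u)_{[k,k+\ell-1]})_{1\le k\le|\vartheta(u_1)|}$, and let $(M_{\vartheta_\ell})_{uv}=\mathbb E|\vartheta_\ell(v)|_u$ for $u,v\in\mathcal A_\ell$. It is known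 that for expanding primitive $\vartheta$ the matrix $M_{\vartheta_\ell}$ is primitive with the same Perron–Frobenius eigenvalue $\lambda$ as $M_\vartheta$. $R^{(\ell)}$ denotes its right Perron–Frobenius eigenvector with $\|R^{(\ell)}\|_1=1$. Frequency measure. $\mathcal Z_{[k,m]}(v)=\{x\in\mathbb X_\vartheta:x_{[k,m]}=v\}$ for $k\le m$, $v\in\mathcal L_\vartheta^{m-k+1}$. $\mu_\vartheta$ is the unique (shift-invariant) Borel probability measure on $\mathbb X_\vartheta$ with $\mu_\vartheta(\mathcal Z_{[k,m]}(v))=R^{(m-k+1)}_v$ for all $k\le 0\le m$ and $v\in\mathcal L_\vartheta^{m-k+1}$. *)

theory Defs
  imports "HOL-Probability.Probability"
begin

section \<open>Words\<close>

text \<open>Words are lists; the empty list is not a word and is excluded explicitly where it matters.\<close>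

definition occ :: "'b list \<Rightarrow> 'b list \<Rightarrow> nat" where
  "occ u v = card {k. k + length v \<le> length u \<and> take (length v) (drop k u) = v}"

definition subword :: "'b list \<Rightarrow> 'b list \<Rightarrow> bool" where
  "subword v u \<longleftrightarrow> occ u v \<ge> 1"

definition window :: "(int \<Rightarrow> 'a) \<Rightarrow> int \<Rightarrow> int \<Rightarrow> 'a list" where
  "window x k m = map x [k..m]"

section \<open>Random substitutions\<close>

definition random_substitution :: "('a::finite \<Rightarrow> 'a list pmf) \<Rightarrow> bool" where
  "random_substitution \<theta> \<longleftrightarrow> (\<forall>a. finite (set_pmf (\<theta> a)) \<and> [] \<notin> set_pmf (\<theta> a))"

text \<open>The joint law of the independent images of the letters of a word.\<close>

fun subst_pieces :: "('a \<Rightarrow> 'a list pmf) \<Rightarrow> 'a list \<Rightarrow> 'a list list pmf" where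
  "subst_pieces \<theta> [] = return_pmf []"
| "subst_pieces \<theta> (a # u) = map_pmf (\<lambda>(w, ws). w # ws) (pair_pmf (\<theta> a) (subst_pieces \<theta> u))"

lemma pmf_subst_pieces:
  "pmf (subst_pieces \<theta> u) ws =
     (if length ws = length u then (\<Prod>i<length u. pmf (\<theta> (u ! i)) (ws ! i)) else 0)"
proof (induction u arbitrary: ws)
  case Nil
  then show ?case by (simp add: pmf_return)
next
  case (Cons a u)
  show ?case
  proof (cases ws)
    case Nil
    then have "ws \<notin> set_pmf (subst_pieces \<theta> (a # u))" by auto
    then show ?thesis using Nil by (simp add: pmf_eq_0_set_pmf)
  next
    case (Cons w ws')
    have "inj (\<lambda>(w :: 'a list, ws). w # ws)" by (auto simp: inj_def)
    from pmf_map_inj'[OF this, of "pair_pmf (\<theta> a) (subst_pieces \<theta> u)" "(w, ws')"]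
    have "pmf (subst_pieces \<theta> (a # u)) ws = pmf (\<theta> a) w * pmf (subst_pieces \<theta> u) ws'"
      using Cons by (simp add: pmf_pair)
    then show ?thesis
      using Cons by (simp add: Cons.IH prod.lessThan_Suc_shift del: prod.lessThan_Suc)
  qed
qed

text \<open>The transition kernel: \<open>pmf (subst_word \<theta> u) v\<close> is the sum, over all factorisations of
  \<open>v\<close> into as many pieces as \<open>u\<close> has letters, of the products in \<open>pmf_subst_pieces\<close>.\<close>

definition subst_word :: "('a \<Rightarrow> 'a list pmf) \<Rightarrow> 'a list \<Rightarrow> 'a list pmf" where
  "subst_word \<theta> u = map_pmf concat (subst_pieces \<theta> u)"

definition subst_iter :: "('a \<Rightarrow> 'a list pmf) \<Rightarrow> nat \<Rightarrow> 'a list \<Rightarrow> 'a list pmf" where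
  "subst_iter \<theta> n u = ((\<lambda>p. bind_pmf p (subst_word \<theta>)) ^^ n) (return_pmf u)"

definition subst_matrix :: "('a::finite \<Rightarrow> 'a list pmf) \<Rightarrow> real ^ 'a ^ 'a" where
  "subst_matrix \<theta> =
     (\<chi> a b. measure_pmf.expectation (subst_word \<theta> [b]) (\<lambda>w. real (occ w [a])))"

definition primitive_matrix :: "real ^ 'n ^ 'n \<Rightarrow> bool" where
  "primitive_matrix M \<longleftrightarrow>
     (\<forall>i j. M $ i $ j \<ge> 0) \<and> (\<exists>k\<ge>1. \<forall>i j. (((**) M ^^ k) (mat 1)) $ i $ j > 0)"

definition primitive_subst :: "('a::finite \<Rightarrow> 'a list pmf) \<Rightarrow> bool" where
  "primitive_subst \<theta> \<longleftrightarrow> primitive_matrix (subst_matrix \<theta>)"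

definition expanding_subst :: "('a \<Rightarrow> 'a list pmf) \<Rightarrow> bool" where
  "expanding_subst \<theta> \<longleftrightarrow> (\<exists>a. measure_pmf.prob (subst_word \<theta> [a]) {w. length w > 1} > 0)"

section \<open>Language and subshift\<close>

definition language :: "('a \<Rightarrow> 'a list pmf) \<Rightarrow> 'a list set" where
  "language \<theta> =
     {u. u \<noteq> [] \<and> (\<exists>n a v. pmf (subst_iter \<theta> n [a]) v > 0 \<and> subword u v)}"

definition legal_words :: "('a \<Rightarrow> 'a list pmf) \<Rightarrow> nat \<Rightarrow> 'a list set" where
  "legal_words \<theta> l = {u \<in> language \<theta>. length u = l}"

definition subshift :: "('a \<Rightarrow> 'a list pmf) \<Rightarrow> (int \<Rightarrow> 'a) set" where
  "subshift \<theta> = {x. \<forall>k m. k \<le> m \<longrightarrow> window x k m \<in> language \<theta>}"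

text \<open>The product of the discrete topologies on the alphabet, restricted to the subshift.\<close>

definition subshift_topology :: "('a \<Rightarrow> 'a list pmf) \<Rightarrow> (int \<Rightarrow> 'a) topology" where
  "subshift_topology \<theta> =
     subtopology (product_topology (\<lambda>_. discrete_topology UNIV) UNIV) (subshift \<theta>)"

section \<open>Induced substitutions and Perron--Frobenius vectors\<close>

text \<open>The induced random word over the alphabet of legal words of length \<open>l\<close>. Positions are
  counted from \<open>0\<close>, and \<open>hd ws\<close> is the image of the first letter of \<open>u\<close>.\<close>

definition induced_subst :: "('a \<Rightarrow> 'a list pmf) \<Rightarrow> nat \<Rightarrow> 'a list \<Rightarrow> 'a list list pmf" where
  "induced_subst \<theta> l u =
     map_pmf (\<lambda>ws. map (\<lambda>k. take l (drop k (concat ws))) [0..<length (hd ws)])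
       (subst_pieces \<theta> u)"

definition induced_matrix :: "('a \<Rightarrow> 'a list pmf) \<Rightarrow> nat \<Rightarrow> 'a list \<Rightarrow> 'a list \<Rightarrow> real" where
  "induced_matrix \<theta> l u v =
     measure_pmf.expectation (induced_subst \<theta> l v) (\<lambda>w. real (occ w [u]))"

text \<open>Matrices whose index set depends on \<open>l\<close> are functions used only on a finite set \<open>I\<close> of
  indices; the Perron--Frobenius eigenvalue is the largest modulus of a complex eigenvalue.\<close>

definition eigenvalue_on :: "'i set \<Rightarrow> ('i \<Rightarrow> 'i \<Rightarrow> real) \<Rightarrow> complex \<Rightarrow> bool" where
  "eigenvalue_on I M z \<longleftrightarrow>
     (\<exists>x. (\<exists>i\<in>I. x i \<noteq> 0) \<and> (\<forall>i\<in>I. (\<Sum>j\<in>I. of_real (M i j) * x j) = z * x i))"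

definition PF_eigenvalue :: "'i set \<Rightarrow> ('i \<Rightarrow> 'i \<Rightarrow> real) \<Rightarrow> real" where
  "PF_eigenvalue I M = Sup {cmod z |z. eigenvalue_on I M z}"

definition is_PF_vector :: "'i set \<Rightarrow> ('i \<Rightarrow> 'i \<Rightarrow> real) \<Rightarrow> ('i \<Rightarrow> real) \<Rightarrow> bool" where
  "is_PF_vector I M R \<longleftrightarrow>
     (\<forall>i\<in>I. R i > 0) \<and>
     (\<forall>i\<in>I. (\<Sum>j\<in>I. M i j * R j) = PF_eigenvalue I M * R i) \<and>
     (\<Sum>i\<in>I. \<bar>R i\<bar>) = 1"

text \<open>Extended by \<open>0\<close> outside the legal words, so that the description is definite.\<close>

definition PF_vector :: "('a \<Rightarrow> 'a list pmf) \<Rightarrow> nat \<Rightarrow> 'a list \<Rightarrow> real" where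
  "PF_vector \<theta> l =
     (THE R. is_PF_vector (legal_words \<theta> l) (induced_matrix \<theta> l) R \<and>
             (\<forall>u. u \<notin> legal_words \<theta> l \<longrightarrow> R u = 0))"

section \<open>The frequency measure\<close>

definition cylinder :: "('a \<Rightarrow> 'a list pmf) \<Rightarrow> int \<Rightarrow> int \<Rightarrow> 'a list \<Rightarrow> (int \<Rightarrow> 'a) set" where
  "cylinder \<theta> k m v = {x \<in> subshift \<theta>. window x k m = v}"

text \<open>Borel probability measures on the subshift with the prescribed values on cylinders. These
  values already determine the measure, and force it to be shift-invariant.\<close>

definition frequency_measure :: "('a \<Rightarrow> 'a list pmf) \<Rightarrow> (int \<Rightarrow> 'a) measure \<Rightarrow> bool" where
  "frequency_measure \<theta> \<mu> \<longleftrightarrow>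
     prob_space \<mu> \<and>
     space \<mu> = subshift \<theta> \<and>
     sets \<mu> = sigma_sets (subshift \<theta>) {U. openin (subshift_topology \<theta>) U} \<and>
     (\<forall>k m v. k \<le> 0 \<and> 0 \<le> m \<and> v \<in> legal_words \<theta> (nat (m - k + 1)) \<longrightarrow>
        measure \<mu> (cylinder \<theta> k m v) = PF_vector \<theta> (nat (m - k + 1)) v)"

end

theory Submission
  imports Defs
begin

text \<open>The law of a \<open>\<mu>\<close>-random window of length \<open>d\<close> is the Perron--Frobenius vector \<open>R\<^sup>d\<close>
  of the induced matrix. Being an eigenvector for an eigenvalue at least \<open>1\<close>, it is dominated,
  for every fixed \<open>n\<close>, by the law of a window starting in the first block of the image of an
  \<open>R\<^sup>d\<close>-random word under the \<open>n\<close>-th iterate. Such an image is a concatenation of independent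
  blocks of bounded length. By Perron--Frobenius convergence for words of length \<open>l\<close>, if \<open>n\<close> is
  large then for every letter the expected number of occurrences of \<open>v\<close> in its block, up to a boundary
  error of \<open>l\<close>, is within a factor \<open>R v \<plusminus> \<epsilon>\<close> of the expected block length. So
  \<open>occ w v + l - (R v + \<epsilon>) |w|\<close> and \<open>(R v - \<epsilon>) |w| - occ w v\<close> have negative means on all blocks,
  whatever the letter, and Chernoff's method gives deviation probabilities that decay
  exponentially in \<open>d\<close>. These are summable along strictly increasing lengths, and Borel--Cantelli
  finishes the proof.\<close>

section \<open>Random substitutions and the transfer operator\<close>

text \<open>The intervals may drift and need not be nested, so a pointwise ergodic theorem would not
  give the limit; the argument uses summable tail bounds for single windows, which involve only the
  laws \<open>PF_vector \<theta> d\<close>. The domination is a duality: \<open>transfer\<close> is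
  the transpose of the induced matrix, so pairing \<open>transfer (pow n) d g\<close> with the
  eigenvector multiplies the pairing with \<open>g\<close> by \<rho> ^ n \<ge> 1. The matrix grows
  with \<open>d\<close>, but \<open>n\<close> is fixed before \<open>d\<close>, so no constant
  depends on \<open>d\<close>. Block lengths are random and correlated with the counts, which is why
  both enter through one linear combination per block. The number of blocks meeting a window is
  random too; a union over at most \<open>d + 1\<close> prefixes costs a polynomial factor.
  Perron-Frobenius convergence concerns columns indexed by words; it descends to letters because
  every letter starts a legal word, and the entry for \<open>v\<close> in that word's column differs
  from the mean count in the first block by at most \<open>l\<close>.\<close>

abbreviation expect :: "'b pmf \<Rightarrow> ('b \<Rightarrow> real) \<Rightarrow> real" where
  "expect p f \<equiv> measure_pmf.expectation p f"

lemma expect_sum_pmf: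
  "finite (set_pmf p) \<Longrightarrow> expect p f = (\<Sum>x\<in>set_pmf p. pmf p x * f x)"
  by (subst integral_measure_pmf[of "set_pmf p"]) auto

lemma expect_bind:
  assumes "finite (set_pmf p)" "\<And>x. x \<in> set_pmf p \<Longrightarrow> finite (set_pmf (f x))"
  shows "expect (bind_pmf p f) h = expect p (\<lambda>x. expect (f x) h)"
  using assms by (subst pmf_expectation_bind[of "set_pmf p"]) (auto simp: expect_sum_pmf)

lemma expect_cong:
  "(\<And>x. x \<in> set_pmf p \<Longrightarrow> f x = g x) \<Longrightarrow> expect p f = expect p g"
  by (intro integral_cong_AE) (auto simp: AE_measure_pmf_iff)

lemma expect_mono:
  assumes "finite (set_pmf p)" "\<And>x. x \<in> set_pmf p \<Longrightarrow> f x \<le> g x"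
  shows "expect p f \<le> expect p g"
  using assms by (auto simp: expect_sum_pmf intro!: sum_mono mult_left_mono)

lemma expect_add:
  "finite (set_pmf p) \<Longrightarrow> expect p (\<lambda>x. f x + g x) = expect p f + expect p g"
  by (simp add: expect_sum_pmf sum.distrib algebra_simps)

lemma expect_diff:
  "finite (set_pmf p) \<Longrightarrow> expect p (\<lambda>x. f x - g x) = expect p f - expect p g"
  by (simp add: expect_sum_pmf sum_subtractf algebra_simps)

lemma expect_sum:
  "finite (set_pmf p) \<Longrightarrow> expect p (\<lambda>x. \<Sum>i\<in>I. f i x) = (\<Sum>i\<in>I. expect p (f i))"
  by (simp add: integrable_measure_pmf_finite)

lemma expect_swap:
  assumes "finite (set_pmf p)" "finite (set_pmf q)"
  shows "expect p (\<lambda>x. expect q (f x)) = expect q (\<lambda>y. expect p (\<lambda>x. f x y))"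
  using assms
  by (simp add: expect_sum_pmf sum_distrib_left mult.left_commute sum.swap[of _ "set_pmf p"])

lemma expect_pos:
  assumes "finite (set_pmf p)" "\<And>x. x \<in> set_pmf p \<Longrightarrow> f x \<ge> 0" "x \<in> set_pmf p" "f x > 0"
  shows "expect p f > 0"
  unfolding expect_sum_pmf[OF assms(1)]
  using assms by (intro sum_pos2[of _ x]) (auto simp: pmf_positive)

lemma expect_nonneg:
  "(\<And>x. x \<in> set_pmf p \<Longrightarrow> f x \<ge> 0) \<Longrightarrow> expect p f \<ge> 0"
  by (intro integral_nonneg_AE) (auto simp: AE_measure_pmf_iff)

section \<open>Random images of words: supports, concatenation, lengths\<close>

lemma random_substitutionD:
  assumes "random_substitution \<theta>"
  shows "finite (set_pmf (\<theta> a))" "w \<in> set_pmf (\<theta> a) \<Longrightarrow> w \<noteq> []"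
  using assms by (auto simp: random_substitution_def)

lemma set_subst_pieces:
  "set_pmf (subst_pieces \<theta> u) = {ws. list_all2 (\<lambda>w a. w \<in> set_pmf (\<theta> a)) ws u}"
proof (induction u)
  case (Cons a u)
  show ?case by (auto simp: Cons list_all2_Cons2)
qed auto

lemma finite_subst_pieces:
  "random_substitution \<theta> \<Longrightarrow> finite (set_pmf (subst_pieces \<theta> u))"
  by (induction u) (auto simp: random_substitutionD)

lemma finite_subst_word:
  "random_substitution \<theta> \<Longrightarrow> finite (set_pmf (subst_word \<theta> u))"
  by (simp add: subst_word_def finite_subst_pieces)

lemma subst_word_Nil [simp]: "subst_word \<theta> [] = return_pmf []"
  by (simp add: subst_word_def)

lemma subst_word_Cons:
  "subst_word \<theta> (a # u) = bind_pmf (\<theta> a) (\<lambda>x. map_pmf (append x) (subst_word \<theta> u))"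
  by (simp add: subst_word_def pair_pmf_def map_bind_pmf bind_return_pmf map_pmf_comp
      map_pmf_def bind_assoc_pmf)

lemma subst_word_single [simp]: "subst_word \<theta> [a] = \<theta> a"
  by (simp add: subst_word_Cons bind_return_pmf')

lemma subst_word_append:
  "subst_word \<theta> (u @ v) = bind_pmf (subst_word \<theta> u) (\<lambda>x. map_pmf (append x) (subst_word \<theta> v))"
  by (induction u)
    (simp_all add: subst_word_Cons bind_return_pmf map_pmf_def bind_assoc_pmf map_pmf_id[unfolded id_def]
      bind_return_pmf')

lemma set_subst_word_append:
  "set_pmf (subst_word \<theta> (u @ v)) = {x @ y | x y. x \<in> set_pmf (subst_word \<theta> u) \<and> y \<in> set_pmf (subst_word \<theta> v)}"
  by (auto simp: subst_word_append)

lemma expect_subst_word_append: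
  assumes "random_substitution \<theta>"
  shows "expect (subst_word \<theta> (u @ v)) f =
    expect (subst_word \<theta> u) (\<lambda>x. expect (subst_word \<theta> v) (\<lambda>y. f (x @ y)))"
  using assms by (simp add: subst_word_append expect_bind finite_subst_word)

lemma length_subst_word:
  assumes "random_substitution \<theta>" "w \<in> set_pmf (subst_word \<theta> u)"
  shows "length u \<le> length w"
  using assms(2)
proof (induction u arbitrary: w)
  case (Cons a u)
  then obtain x y where "w = x @ y" "x \<in> set_pmf (\<theta> a)" "y \<in> set_pmf (subst_word \<theta> u)"
    by (auto simp: subst_word_Cons)
  with Cons.IH[of y] random_substitutionD(2)[OF assms(1), of x a] show ?case
    by (cases x) auto
qed auto

text \<open>Iterates are treated as random substitutions in their own right, given by their laws on
  letters, so that statements about a general \<open>\<theta>\<close> can be applied to them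
  directly.\<close>

definition subst_power :: "('a \<Rightarrow> 'a list pmf) \<Rightarrow> nat \<Rightarrow> 'a \<Rightarrow> 'a list pmf" where
  "subst_power \<theta> n a = subst_iter \<theta> n [a]"

lemma subst_word_comp:
  "subst_word (\<lambda>a. bind_pmf (\<theta> a) (subst_word \<phi>)) u = bind_pmf (subst_word \<theta> u) (subst_word \<phi>)"
proof (induction u)
  case (Cons a u)
  have "subst_word (\<lambda>a. bind_pmf (\<theta> a) (subst_word \<phi>)) (a # u) =
    bind_pmf (\<theta> a) (\<lambda>x. bind_pmf (subst_word \<phi> x) (\<lambda>x'.
      bind_pmf (subst_word \<theta> u) (\<lambda>y. bind_pmf (subst_word \<phi> y) (\<lambda>y'. return_pmf (x' @ y')))))"
    by (simp add: subst_word_Cons Cons map_pmf_def bind_assoc_pmf)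
  \<comment> \<open>The second-stage draw on \<open>x\<close> and the first-stage draw on
    \<open>u\<close> are independent and may be exchanged; then both first-stage draws come
    first.\<close>
  also have "\<dots> = bind_pmf (\<theta> a) (\<lambda>x. bind_pmf (subst_word \<theta> u) (\<lambda>y. 
     bind_pmf (subst_word \<phi> x) (\<lambda>x'. bind_pmf (subst_word \<phi> y) (\<lambda>y'. return_pmf (x' @ y')))))"
    by (subst bind_commute_pmf) simp
  finally show ?case
    by (simp add: subst_word_Cons subst_word_append map_pmf_def bind_assoc_pmf bind_return_pmf)
qed (simp add: bind_return_pmf)

lemma subst_iter_0: "subst_iter \<theta> 0 u = return_pmf u"
  by (simp add: subst_iter_def)

lemma subst_iter_Suc: "subst_iter \<theta> (Suc n) u = bind_pmf (subst_iter \<theta> n u) (subst_word \<theta>)"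
  by (simp add: subst_iter_def)

lemma subst_word_return [simp]: "subst_word (\<lambda>a. return_pmf [a]) u = return_pmf u"
  by (induction u) (simp_all add: subst_word_Cons bind_return_pmf)

lemma subst_power_0: "subst_power \<theta> 0 a = return_pmf [a]"
  by (simp add: subst_power_def subst_iter_0)

lemma subst_power_1 [simp]: "subst_power \<theta> (Suc 0) = \<theta>"
  by (simp add: subst_power_def subst_iter_0 subst_iter_Suc fun_eq_iff bind_return_pmf)

lemma subst_power_add:
  "subst_power \<theta> (m + n) = (\<lambda>a. bind_pmf (subst_power \<theta> m a) (subst_word (subst_power \<theta> n)))"
proof (induction n)
  case 0
  then show ?case by (simp add: subst_power_0[abs_def] bind_return_pmf')
next
  case (Suc n)
  have *: "subst_power \<theta> (Suc n) = (\<lambda>a. bind_pmf (subst_power \<theta> n a) (subst_word \<theta>))" for n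
    by (simp add: subst_power_def fun_eq_iff subst_iter_Suc)
  show ?case
    by (simp add: * Suc bind_assoc_pmf subst_word_comp)
qed

lemma random_substitution_comp:
  assumes "random_substitution \<theta>" "random_substitution \<phi>"
  shows "random_substitution (\<lambda>a. bind_pmf (\<theta> a) (subst_word \<phi>))"
proof -
  have False if "x \<in> set_pmf (\<theta> a)" "[] \<in> set_pmf (subst_word \<phi> x)" for x a
    using length_subst_word[OF assms(2) that(2)] random_substitutionD(2)[OF assms(1) that(1)] by simp
  then show ?thesis
    using assms by (auto simp: random_substitution_def intro!: finite_subst_word)
qed

lemma random_substitution_power:
  assumes "random_substitution \<theta>"
  shows "random_substitution (subst_power \<theta> n)"
proof (induction n)
  case 0
  then show ?case by (simp add: random_substitution_def subst_power_0)
next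
  case (Suc n)
  then show ?case
    using random_substitution_comp[OF Suc assms] subst_power_add[of \<theta> n 1] by simp
qed

text \<open>The second word only supplies letters to windows that start near the end of the first.
  The asymmetry matches the induced substitution, which keeps the windows starting in the image of
  the first letter.\<close>

definition window_sum :: "nat \<Rightarrow> ('a list \<Rightarrow> real) \<Rightarrow> 'a list \<Rightarrow> 'a list \<Rightarrow> real" where
  "window_sum l g x y = (\<Sum>k<length x. g (take l (drop k (x @ y))))"

text \<open>The transpose of \<open>induced_matrix\<close>, acting on functions of words (see
  \<open>transfer_expand\<close>). Composition is natural for arbitrary observables, and the
  deviation bound applies it to indicators of whole sets of words.\<close>

definition transfer :: "('a \<Rightarrow> 'a list pmf) \<Rightarrow> nat \<Rightarrow> ('a list \<Rightarrow> real) \<Rightarrow> 'a list \<Rightarrow> real" where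
  "transfer \<theta> l g u = expect (subst_pieces \<theta> u) (\<lambda>ws. window_sum l g (hd ws) (concat (tl ws)))"

lemma expect_subst_pieces_Cons:
  assumes "random_substitution \<theta>"
  shows "expect (subst_pieces \<theta> (a # u)) f =
    expect (\<theta> a) (\<lambda>x. expect (subst_pieces \<theta> u) (\<lambda>ws. f (x # ws)))"
  using assms by (simp add: pair_pmf_def map_bind_pmf expect_bind finite_subst_pieces
      random_substitutionD)

lemma transfer_Cons:
  assumes "random_substitution \<theta>"
  shows "transfer \<theta> l g (a # u) =
    expect (\<theta> a) (\<lambda>x. expect (subst_word \<theta> u) (\<lambda>y. window_sum l g x y))"
  unfolding transfer_def expect_subst_pieces_Cons[OF assms] by (simp add: subst_word_def)

lemma window_sum_append_left:
  "window_sum l g (x @ x') y = window_sum l g x (x' @ y) + window_sum l g x' y"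
proof -
  have "(\<Sum>k<length x + length x'. f k) = (\<Sum>k<length x. f k) + (\<Sum>k<length x'. f (length x + k))"
    for f :: "nat \<Rightarrow> real"
    using sum.atLeastLessThan_concat[of 0 "length x" "length x + length x'" f]
      sum.shift_bounds_nat_ivl[of f 0 "length x" "length x'"]
    by (simp add: lessThan_atLeast0 add.commute)
  then show ?thesis by (simp add: window_sum_def)
qed

text \<open>A window that starts at the last letter of \<open>x\<close> reaches only
  \<open>l - 1\<close> letters beyond it, so whatever follows them is invisible.\<close>

lemma window_sum_append_right:
  "l \<le> Suc (length y) \<Longrightarrow> window_sum l g x (y @ z) = window_sum l g x y"
  by (auto simp: window_sum_def intro!: sum.cong)

text \<open>Windows starting in the image of \<open>w\<close> are grouped by the letter of
  \<open>w\<close> whose image contains the start. As images are nonempty, such a window meets only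
  the images of that letter and of the next \<open>l - 1\<close> letters, which is one evaluation of
  \<open>transfer\<close>.\<close>

lemma expect_window_sum:
  assumes \<phi>: "random_substitution \<phi>" and "l \<le> Suc (length x)" "l > 0"
  shows "expect (subst_word \<phi> w) (\<lambda>w'. expect (subst_word \<phi> x) (\<lambda>x'. window_sum l g w' x'))
    = window_sum l (transfer \<phi> l g) w x"
proof (induction w)
  case Nil
  then show ?case by (simp add: window_sum_def)
next
  case (Cons c w)
  note fin = finite_subst_word[OF \<phi>]
  define z where "z = take (l - 1) (w @ x)"
  have z: "length z = l - 1" using assms by (simp add: z_def)
  have wx: "w @ x = z @ drop (l - 1) (w @ x)" by (simp only: z_def append_take_drop_id)
  have "expect (subst_word \<phi> (c # w)) (\<lambda>w'. expect (subst_word \<phi> x) (\<lambda>x'. window_sum l g w' x'))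
    = expect (subst_word \<phi> ([c] @ w)) (\<lambda>w'. expect (subst_word \<phi> x) (\<lambda>x'. window_sum l g w' x'))"
    by simp
  also have "\<dots> = expect (\<phi> c) (\<lambda>c'. expect (subst_word \<phi> w) (\<lambda>w'. expect (subst_word \<phi> x)
      (\<lambda>x'. window_sum l g c' (w' @ x')))) +
      expect (\<phi> c) (\<lambda>_. expect (subst_word \<phi> w) (\<lambda>w'. expect (subst_word \<phi> x) (\<lambda>x'. window_sum l g w' x')))"
    unfolding expect_subst_word_append[OF \<phi>] window_sum_append_left
    by (simp add: expect_add fin random_substitutionD[OF \<phi>])
  also have "expect (\<phi> c) (\<lambda>c'. expect (subst_word \<phi> w) (\<lambda>w'. expect (subst_word \<phi> x)
      (\<lambda>x'. window_sum l g c' (w' @ x')))) = 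
      expect (\<phi> c) (\<lambda>c'. expect (subst_word \<phi> (w @ x)) (\<lambda>y. window_sum l g c' y))"
    by (simp add: expect_subst_word_append \<phi>)
  also have "\<dots> = expect (\<phi> c) (\<lambda>c'. expect (subst_word \<phi> z) (\<lambda>y. window_sum l g c' y))"
  proof (rule expect_cong)
    fix c'
    show "expect (subst_word \<phi> (w @ x)) (\<lambda>y. window_sum l g c' y) =
        expect (subst_word \<phi> z) (\<lambda>y. window_sum l g c' y)"
      apply (subst wx)
      apply (subst expect_subst_word_append[OF \<phi>])
      apply (rule expect_cong)
      subgoal for y
        using length_subst_word[OF \<phi>, of y z] z assms
        by (simp add: window_sum_append_right)
      done
  qed
  also have "\<dots> = transfer \<phi> l g (take l (c # w @ x))"
    using \<open>l > 0\<close> by (cases l) (simp_all add: transfer_Cons[OF \<phi>] z_def)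
  also have "take l (c # w @ x) = take l (drop 0 ([c] @ w @ x))" by simp
  also have "transfer \<phi> l g \<dots> = window_sum l (transfer \<phi> l g) [c] (w @ x)"
    unfolding window_sum_def by simp
  also have "expect (\<phi> c) (\<lambda>_. expect (subst_word \<phi> w) (\<lambda>w'. expect (subst_word \<phi> x)
      (\<lambda>x'. window_sum l g w' x'))) = window_sum l (transfer \<phi> l g) w x"
    using Cons by simp
  finally show ?case
    using window_sum_append_left[of l "transfer \<phi> l g" "[c]" w x] by simp
qed

lemma transfer_comp:
  assumes \<theta>: "random_substitution \<theta>" and \<phi>: "random_substitution \<phi>" and "length u = l" "u \<noteq> []"
  shows "transfer (\<lambda>a. bind_pmf (\<theta> a) (subst_word \<phi>)) l g u = transfer \<theta> l (transfer \<phi> l g) u"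
proof -
  obtain a w where u: "u = a # w" using assms by (cases u) auto
  have "transfer (\<lambda>a. bind_pmf (\<theta> a) (subst_word \<phi>)) l g u =
     expect (\<theta> a) (\<lambda>x. expect (subst_word \<phi> x) (\<lambda>x'. expect (subst_word \<theta> w)
      (\<lambda>y. expect (subst_word \<phi> y) (\<lambda>y'. window_sum l g x' y'))))"
    unfolding u transfer_Cons[OF random_substitution_comp[OF \<theta> \<phi>]] subst_word_comp
    by (simp add: expect_bind finite_subst_word \<theta> \<phi> random_substitutionD)
  \<comment> \<open>All first-stage draws are moved outside, so that both words are fixed when
    \<open>expect_window_sum\<close> treats the second stage.\<close>
  also have "\<dots> = expect (\<theta> a) (\<lambda>x. expect (subst_word \<theta> w) (\<lambda>y. expect (subst_word \<phi> x)
      (\<lambda>x'. expect (subst_word \<phi> y) (\<lambda>y'. window_sum l g x' y'))))"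
    by (intro expect_cong expect_swap finite_subst_word \<theta> \<phi>)
  also have "\<dots> = expect (\<theta> a) (\<lambda>x. expect (subst_word \<theta> w) (\<lambda>y. window_sum l (transfer \<phi> l g) x y))"
    apply (intro expect_cong)
    apply (rule expect_window_sum[OF \<phi>])
    using assms(3) by (auto simp: u dest!: length_subst_word[OF \<theta>])
  finally show ?thesis by (simp add: u transfer_Cons[OF \<theta>])
qed

lemma transfer_power_add:
  assumes "random_substitution \<theta>" "length u = l" "u \<noteq> []"
  shows "transfer (subst_power \<theta> (m + n)) l g u =
    transfer (subst_power \<theta> m) l (transfer (subst_power \<theta> n) l g) u"
  unfolding subst_power_add using assms
  by (intro transfer_comp) (auto simp: random_substitution_power)

section \<open>Perron--Frobenius theory for positive matrix semigroups\<close>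

text \<open>\<open>A n\<close> stands for the n-th power of \<open>A 1\<close>; the semigroup law is
  what composing transfer operators delivers. \<open>col_pos\<close> allows columns to be normalised
  at all times, also before time \<open>k\<close>.\<close>

locale positive_semigroup =
  fixes I :: "'i set" and A :: "nat \<Rightarrow> 'i \<Rightarrow> 'i \<Rightarrow> real" and k :: nat
  assumes finite_I: "finite I" and I_ne: "I \<noteq> {}"
    and nonneg: "\<And>n i j. i \<in> I \<Longrightarrow> j \<in> I \<Longrightarrow> A n i j \<ge> 0"
    and add: "\<And>m n i j. i \<in> I \<Longrightarrow> j \<in> I \<Longrightarrow> A (m + n) i j = (\<Sum>w\<in>I. A m i w * A n w j)"
    and col_pos: "\<And>n j. j \<in> I \<Longrightarrow> (\<Sum>i\<in>I. A n i j) > 0"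
    and k_pos: "\<And>i j. i \<in> I \<Longrightarrow> j \<in> I \<Longrightarrow> A k i j > 0"
begin

definition col :: "nat \<Rightarrow> 'i \<Rightarrow> real" where
  "col n j = (\<Sum>i\<in>I. A n i j)"

text \<open>Columns scaled to mass 1. The scaling removes the unknown growth rate, so a limit can be
  found before any eigenvalue is identified.\<close>

definition ratio :: "'i \<Rightarrow> nat \<Rightarrow> 'i \<Rightarrow> real" where
  "ratio i n j = A n i j / col n j"

text \<open>Ratios at time \<open>n + m\<close> are averages of ratios at time \<open>n\<close> with these stochastic weights. For
  \<open>m = k\<close> and \<open>n \<ge> k\<close> the weights have a uniform positive lower bound (a Doeblin condition), so
  the oscillation over the columns contracts.\<close>

definition weight :: "nat \<Rightarrow> nat \<Rightarrow> 'i \<Rightarrow> 'i \<Rightarrow> real" where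
  "weight n m j w = col n w * A m w j / col (n + m) j"

lemma col_gt_0: "j \<in> I \<Longrightarrow> col n j > 0"
  by (simp add: col_def col_pos)

lemma col_add: "j \<in> I \<Longrightarrow> col (n + m) j = (\<Sum>w\<in>I. col n w * A m w j)"
  unfolding col_def sum_distrib_right by (subst sum.swap) (simp add: add)

lemma weight_nonneg: "j \<in> I \<Longrightarrow> w \<in> I \<Longrightarrow> weight n m j w \<ge> 0"
  by (simp add: weight_def nonneg col_gt_0 less_imp_le)

lemma sum_weight: "j \<in> I \<Longrightarrow> (\<Sum>w\<in>I. weight n m j w) = 1"
  using col_gt_0[of j "n + m"]
  by (simp add: weight_def sum_divide_distrib[symmetric] col_add[symmetric])

lemma ratio_add:
  assumes "i \<in> I" "j \<in> I"
  shows "ratio i (n + m) j = (\<Sum>w\<in>I. weight n m j w * ratio i n w)"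
proof -
  have "weight n m j w * ratio i n w = A n i w * A m w j / col (n + m) j" if "w \<in> I" for w
    using col_gt_0[OF that, of n] by (simp add: weight_def ratio_def)
  then show ?thesis
    by (simp add: ratio_def add assms sum_divide_distrib)
qed

section \<open>Contraction of the oscillation over columns\<close>

definition hi :: "'i \<Rightarrow> nat \<Rightarrow> real" where "hi i n = Max (ratio i n ` I)"
definition lo :: "'i \<Rightarrow> nat \<Rightarrow> real" where "lo i n = Min (ratio i n ` I)"

lemma lo_le: "j \<in> I \<Longrightarrow> lo i n \<le> ratio i n j"
  and le_hi: "j \<in> I \<Longrightarrow> ratio i n j \<le> hi i n"
  by (auto simp: lo_def hi_def finite_I)

lemma lo_le_hi: "lo i n \<le> hi i n"
  using I_ne lo_le le_hi order_trans by blast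

lemma lo_attained: "\<exists>j\<in>I. lo i n = ratio i n j"
  unfolding lo_def using Min_in[of "ratio i n ` I"] finite_I I_ne by blast

lemma hi_attained: "\<exists>j\<in>I. hi i n = ratio i n j"
  unfolding hi_def using Max_in[of "ratio i n ` I"] finite_I I_ne by blast

lemma lo_mono: "i \<in> I \<Longrightarrow> lo i n \<le> lo i (n + m)"
proof -
  assume i: "i \<in> I"
  obtain j where j: "j \<in> I" "lo i (n + m) = ratio i (n + m) j" using lo_attained by blast
  have "lo i n = (\<Sum>w\<in>I. weight n m j w * lo i n)"
    using sum_weight[OF j(1)] by (simp add: sum_distrib_right[symmetric])
  also have "\<dots> \<le> (\<Sum>w\<in>I. weight n m j w * ratio i n w)"
    by (intro sum_mono mult_left_mono lo_le weight_nonneg j)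
  finally show ?thesis using ratio_add[OF i j(1)] j by simp
qed

lemma hi_antimono: "i \<in> I \<Longrightarrow> hi i (n + m) \<le> hi i n"
proof -
  assume i: "i \<in> I"
  obtain j where j: "j \<in> I" "hi i (n + m) = ratio i (n + m) j" using hi_attained by blast
  have "(\<Sum>w\<in>I. weight n m j w * ratio i n w) \<le> (\<Sum>w\<in>I. weight n m j w * hi i n)"
    by (intro sum_mono mult_left_mono le_hi weight_nonneg j)
  also have "\<dots> = hi i n"
    using sum_weight[OF j(1)] by (simp add: sum_distrib_right[symmetric])
  finally show ?thesis using ratio_add[OF i j(1)] j by simp
qed

text \<open>One factor \<open>A k\<close> places every \<open>col (k + n) z\<close> between \<alpha>
  and \<beta> times the same total mass \<open>T\<close>; the second factor bounds the numerator
  below and the denominator above. \<open>T\<close> cancels, so the bound does not depend on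
  \<open>n\<close>.\<close>

lemma weight_lower:
  obtains \<delta> where "\<delta> > 0" "\<And>n j w. j \<in> I \<Longrightarrow> w \<in> I \<Longrightarrow> weight (k + n) k j w \<ge> \<delta>"
proof
  define S where "S = (\<lambda>(i, j). A k i j) ` (I \<times> I)"
  have S: "finite S" "S \<noteq> {}" using finite_I I_ne by (auto simp: S_def)
  define \<alpha> where "\<alpha> = Min S"
  define \<beta> where "\<beta> = Max S"
  have \<alpha>: "\<alpha> \<le> A k i j" and \<beta>: "A k i j \<le> \<beta>" if "i \<in> I" "j \<in> I" for i j
    using S that by (auto simp: \<alpha>_def \<beta>_def S_def intro!: Min_le Max_ge)
  have "\<alpha> \<in> S" using S by (simp add: \<alpha>_def)
  then have \<alpha>0: "\<alpha> > 0" using k_pos by (auto simp: S_def)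
  have \<beta>0: "\<beta> > 0" using I_ne k_pos \<beta> less_le_trans by blast
  have card: "real (card I) > 0" using finite_I I_ne by (simp add: card_gt_0_iff)
  define \<delta> where "\<delta> = \<alpha> * \<alpha> / (\<beta> * \<beta> * card I)"
  show "\<delta> > 0" using \<alpha>0 \<beta>0 card by (simp add: \<delta>_def)
  fix n j w assume jw: "j \<in> I" "w \<in> I"
  define T where "T = (\<Sum>z\<in>I. col n z)"
  have T0: "T > 0" using finite_I I_ne by (auto simp: T_def col_gt_0 intro: sum_pos)
  have lower: "\<alpha> * T \<le> col (k + n) z" and upper: "col (k + n) z \<le> \<beta> * T" if "z \<in> I" for z
  proof -
    have eq: "col (k + n) z = (\<Sum>y\<in>I. A k y z * col n y)"
      using col_add[OF that, of n k] by (simp add: add.commute mult.commute)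
    show "\<alpha> * T \<le> col (k + n) z" "col (k + n) z \<le> \<beta> * T"
      unfolding eq T_def sum_distrib_left
      by (intro sum_mono mult_right_mono \<alpha> \<beta> that less_imp_le[OF col_gt_0]; assumption)+
  qed
  have "col (k + n + k) j \<le> (\<Sum>z\<in>I. (\<beta> * T) * \<beta>)"
    unfolding col_add[OF jw(1), of "k + n" k]
    using T0 \<beta>0 by (intro sum_mono mult_mono upper \<beta> nonneg jw) auto
  then have D: "col (k + n + k) j \<le> card I * (\<beta> * T * \<beta>)" by simp
  have N: "\<alpha> * T * \<alpha> \<le> col (k + n) w * A k w j"
    using T0 \<alpha>0 jw by (intro mult_mono lower \<alpha> less_imp_le[OF col_gt_0]) auto
  have "\<delta> = (\<alpha> * T * \<alpha>) / (card I * (\<beta> * T * \<beta>))"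
    using T0 by (simp add: \<delta>_def)
  also have "\<dots> \<le> weight (k + n) k j w"
    unfolding weight_def using N D T0 \<alpha>0 col_gt_0[OF jw(1)]
    by (intro frac_le) (auto intro: mult_nonneg_nonneg nonneg jw less_imp_le[OF col_gt_0])
  finally show "\<delta> \<le> weight (k + n) k j w" .
qed

lemma oscillation_tendsto_0:
  assumes i: "i \<in> I"
  shows "(\<lambda>n. hi i n - lo i n) \<longlonglongrightarrow> 0"
proof -
  obtain \<delta> where \<delta>: "\<delta> > 0" "\<And>n j w. j \<in> I \<Longrightarrow> w \<in> I \<Longrightarrow> weight (k + n) k j w \<ge> \<delta>"
    using weight_lower by blast
  define osc where "osc n = hi i n - lo i n" for n
  have step: "osc (n + k + k) \<le> (1 - \<delta>) * osc (n + k)" for n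
  proof -
    let ?m = "k + n"
    obtain j where j: "j \<in> I" "hi i (?m + k) = ratio i (?m + k) j" using hi_attained by blast
    obtain w where w: "w \<in> I" "lo i ?m = ratio i ?m w" using lo_attained by blast
    have "hi i (?m + k) = (\<Sum>z\<in>I. weight ?m k j z * ratio i ?m z)"
      using ratio_add[OF i j(1)] j by simp
    \<comment> \<open>The column \<open>w\<close> attaining the minimum has weight at least
      \<delta>, so the average stays below the maximum by at least \<delta> times the
      oscillation.\<close>
    also have "\<dots> = weight ?m k j w * lo i ?m + (\<Sum>z\<in>I - {w}. weight ?m k j z * ratio i ?m z)"
      using finite_I w by (simp add: sum.remove)
    also have "(\<Sum>z\<in>I - {w}. weight ?m k j z * ratio i ?m z) \<le> (\<Sum>z\<in>I - {w}. weight ?m k j z * hi i ?m)"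
      by (intro sum_mono mult_left_mono le_hi weight_nonneg j) auto
    also have "\<dots> = (1 - weight ?m k j w) * hi i ?m"
      using sum_weight[OF j(1), of ?m k] finite_I w
      by (simp add: sum.remove sum_distrib_right[symmetric])
    finally have "hi i (?m + k) \<le> hi i ?m - weight ?m k j w * osc ?m"
      by (simp add: osc_def algebra_simps)
    moreover have "weight ?m k j w * osc ?m \<ge> \<delta> * osc ?m"
      using \<delta>(2)[OF j(1) w(1), of n] lo_le_hi[of i ?m] by (intro mult_right_mono) (auto simp: osc_def)
    ultimately show ?thesis using lo_mono[OF i, of ?m k]
      by (simp add: osc_def algebra_simps)
  qed
  have "decseq osc"
    unfolding decseq_Suc_iff using hi_antimono[OF i, of _ 1] lo_mono[OF i, of _ 1]
    by (auto simp: osc_def intro: diff_mono)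
  moreover have "osc n \<ge> 0" for n using lo_le_hi[of i n] by (simp add: osc_def)
  ultimately obtain L where L: "osc \<longlonglongrightarrow> L"
    using decseq_convergent[of osc 0] by blast
  \<comment> \<open>The limit inherits the contraction, which forces it to vanish.\<close>
  have "L \<le> (1 - \<delta>) * L"
    using LIMSEQ_ignore_initial_segment[OF L, of "k + k"]
      tendsto_mult[OF tendsto_const[of "1 - \<delta>"] LIMSEQ_ignore_initial_segment[OF L, of k]] step
    by (intro LIMSEQ_le) (auto simp: add.assoc)
  moreover have "L \<ge> 0" using L \<open>\<And>n. osc n \<ge> 0\<close> by (intro LIMSEQ_le_const) auto
  ultimately have "L = 0" using \<delta>(1) by (auto simp: algebra_simps mult_le_0_iff)
  with L show ?thesis by (simp add: osc_def[abs_def])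
qed

section \<open>The limit vector as the unique Perron-Frobenius vector\<close>

definition limit :: "'i \<Rightarrow> real" where "limit i = lim (lo i)"

lemma lo_tendsto: "i \<in> I \<Longrightarrow> lo i \<longlonglongrightarrow> limit i"
proof -
  assume i: "i \<in> I"
  have "incseq (lo i)" unfolding incseq_Suc_iff using lo_mono[OF i, of _ 1] by simp
  moreover have "lo i n \<le> hi i 0" for n
    using lo_le_hi[of i n] hi_antimono[OF i, of 0 n] by simp
  ultimately obtain L where "lo i \<longlonglongrightarrow> L" using incseq_convergent by blast
  then show ?thesis by (simp add: limit_def limI)
qed

lemma hi_tendsto: "i \<in> I \<Longrightarrow> hi i \<longlonglongrightarrow> limit i"
  using tendsto_add[OF oscillation_tendsto_0 lo_tendsto, of i i] by simp

lemma ratio_tendsto: "i \<in> I \<Longrightarrow> j \<in> I \<Longrightarrow> (\<lambda>n. ratio i n j) \<longlonglongrightarrow> limit i"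
  by (rule tendsto_sandwich[OF _ _ lo_tendsto hi_tendsto]) (auto simp: lo_le le_hi)

text \<open>All entries are positive at time \<open>k\<close>, and \<open>lo i\<close> never
  decreases, so the value at time \<open>k\<close> bounds the limit from below.\<close>

lemma limit_pos: "i \<in> I \<Longrightarrow> limit i > 0"
proof -
  assume i: "i \<in> I"
  obtain j where "j \<in> I" "lo i k = ratio i k j" using lo_attained by blast
  then have "lo i k > 0" using i by (simp add: ratio_def k_pos col_gt_0)
  also have "lo i k \<le> limit i"
    using lo_tendsto[OF i] lo_mono[OF i, of k]
    by (intro LIMSEQ_le_const) (auto simp: le_iff_add intro!: exI[of _ k])
  finally show ?thesis .
qed

lemma sum_limit: "(\<Sum>i\<in>I. limit i) = 1"
proof -
  obtain j where j: "j \<in> I" using I_ne by blast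
  have "(\<lambda>n. \<Sum>i\<in>I. ratio i n j) \<longlonglongrightarrow> (\<Sum>i\<in>I. limit i)"
    by (intro tendsto_sum ratio_tendsto j)
  moreover have "(\<Sum>i\<in>I. ratio i n j) = 1" for n
    using col_gt_0[OF j, of n] by (simp add: ratio_def sum_divide_distrib[symmetric] col_def)
  ultimately show ?thesis using LIMSEQ_unique[OF tendsto_const, of 1] by simp
qed

text \<open>As \<open>limit\<close> has total mass 1, the mass of its image under \<open>A 1\<close>
  can only be the eigenvalue.\<close>

definition root :: real where "root = (\<Sum>i\<in>I. \<Sum>j\<in>I. A (Suc 0) i j * limit j)"

text \<open>Dividing the semigroup law for \<open>A (Suc n)\<close> by \<open>col n j\<close> makes
  both sides converge; the growth factor \<open>col (Suc n) j / col n j\<close> tends to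
  \<open>root\<close>.\<close>

lemma limit_eigenvector:
  assumes i: "i \<in> I"
  shows "(\<Sum>j\<in>I. A (Suc 0) i j * limit j) = root * limit i"
proof -
  obtain j where j: "j \<in> I" using I_ne by blast
  have eq: "A (Suc n) i' j / col n j = (\<Sum>w\<in>I. A (Suc 0) i' w * ratio w n j)" if "i' \<in> I" for n i'
    using add[OF that j, of "Suc 0" n] by (simp add: ratio_def sum_divide_distrib)
  have lim: "(\<lambda>n. A (Suc n) i' j / col n j) \<longlonglongrightarrow> (\<Sum>w\<in>I. A (Suc 0) i' w * limit w)" if "i' \<in> I" for i'
    unfolding eq[OF that] by (intro tendsto_sum tendsto_mult tendsto_const ratio_tendsto j)
  have "(\<lambda>n. \<Sum>i'\<in>I. A (Suc n) i' j / col n j) \<longlonglongrightarrow> root"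
    unfolding root_def by (intro tendsto_sum lim)
  then have "(\<lambda>n. col (Suc n) j / col n j) \<longlonglongrightarrow> root"
    by (simp add: sum_divide_distrib[symmetric] col_def)
  then have "(\<lambda>n. col (Suc n) j / col n j * ratio i (Suc n) j) \<longlonglongrightarrow> root * limit i"
    using LIMSEQ_Suc[OF ratio_tendsto[OF i j]] by (intro tendsto_mult)
  moreover have "col (Suc n) j / col n j * ratio i (Suc n) j = A (Suc n) i j / col n j" for n
    using col_gt_0[OF j, of "Suc n"] by (simp add: ratio_def)
  ultimately show ?thesis using LIMSEQ_unique[OF lim[OF i], of "root * limit i"] by (simp only:)
qed

lemma root_nonneg: "root \<ge> 0"
  unfolding root_def by (intro sum_nonneg mult_nonneg_nonneg nonneg less_imp_le[OF limit_pos]) auto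

text \<open>\<open>PF_eigenvalue\<close> is a supremum over complex eigenvalues. In the maximum norm
  weighted by the positive eigenvector \<open>limit\<close> the matrix has norm at most
  \<open>root\<close>, so no eigenvalue has larger modulus; the proof reads this off at the index
  where the weighted maximum \<open>C\<close> is attained.\<close>

lemma PF_eigenvalue_eq: "PF_eigenvalue I (A (Suc 0)) = root"
proof -
  have "eigenvalue_on I (A (Suc 0)) (of_real root)"
    unfolding eigenvalue_on_def
  proof (intro exI[of _ "\<lambda>i. of_real (limit i)"] conjI ballI)
    show "\<exists>i\<in>I. complex_of_real (limit i) \<noteq> 0"
      using I_ne limit_pos by fastforce
    show "(\<Sum>j\<in>I. complex_of_real (A (Suc 0) i j) * complex_of_real (limit j)) =
        complex_of_real root * complex_of_real (limit i)" if "i \<in> I" for i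
      using arg_cong[OF limit_eigenvector[OF that], of complex_of_real] by simp
  qed
  then have "root \<in> {cmod z |z. eigenvalue_on I (A (Suc 0)) z}"
    using root_nonneg by (intro CollectI exI[of _ "of_real root"]) simp
  moreover have "r \<le> root" if rz: "r \<in> {cmod z |z. eigenvalue_on I (A (Suc 0)) z}" for r
  proof -
    obtain z where r: "r = cmod z" and z: "eigenvalue_on I (A (Suc 0)) z"
      using rz by blast
    from z obtain x where x: "\<exists>i\<in>I. x i \<noteq> 0"
      and ev: "\<forall>i\<in>I. (\<Sum>j\<in>I. of_real (A (Suc 0) i j) * x j) = z * x i"
      unfolding eigenvalue_on_def by blast
    define C where "C = Max ((\<lambda>i. cmod (x i) / limit i) ` I)"
    have C: "cmod (x i) \<le> C * limit i" if "i \<in> I" for i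
    proof -
      have "cmod (x i) / limit i \<le> C" using that finite_I by (simp add: C_def)
      then show ?thesis using limit_pos[OF that] by (simp add: field_simps)
    qed
    have "C \<in> (\<lambda>i. cmod (x i) / limit i) ` I"
      unfolding C_def using finite_I I_ne by (intro Max_in) auto
    then obtain i where i: "i \<in> I" "C = cmod (x i) / limit i" by auto
    have "C > 0"
    proof -
      obtain i' where i': "i' \<in> I" "x i' \<noteq> 0" using x by blast
      then have "0 < C * limit i'" using C[OF i'(1)] by (meson less_le_trans zero_less_norm_iff)
      then show ?thesis using limit_pos[OF i'(1)] by (simp add: zero_less_mult_iff)
    qed
    have "r * cmod (x i) = cmod (\<Sum>j\<in>I. of_real (A (Suc 0) i j) * x j)"
      by (simp add: ev i r norm_mult)
    also have "\<dots> \<le> (\<Sum>j\<in>I. A (Suc 0) i j * cmod (x j))"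
      using nonneg[OF i(1)] by (intro order_trans[OF norm_sum]) (simp add: norm_mult)
    also have "\<dots> \<le> (\<Sum>j\<in>I. A (Suc 0) i j * (C * limit j))"
      by (intro sum_mono mult_left_mono C nonneg i)
    also have "\<dots> = C * (\<Sum>j\<in>I. A (Suc 0) i j * limit j)"
      by (simp add: sum_distrib_left mult.left_commute)
    also have "\<dots> = root * (C * limit i)" by (simp add: limit_eigenvector[OF i(1)])
    also have "C * limit i = cmod (x i)" using i limit_pos[OF i(1)] by simp
    finally show "r \<le> root"
      using \<open>C > 0\<close> i limit_pos[OF i(1)] by (simp add: zero_less_divide_iff)
  qed
  ultimately show ?thesis
    unfolding PF_eigenvalue_def by (intro cSup_eq_maximum) auto
qed

lemma eigenvector_power:
  assumes "\<And>i. i \<in> I \<Longrightarrow> (\<Sum>j\<in>I. A (Suc 0) i j * R j) = r * R i" "i \<in> I"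
  shows "(\<Sum>j\<in>I. A (Suc n) i j * R j) = r ^ Suc n * R i"
  using assms(2)
proof (induction n arbitrary: i)
  case (Suc n)
  have "(\<Sum>j\<in>I. A (Suc (Suc n)) i j * R j) = (\<Sum>j\<in>I. \<Sum>w\<in>I. A (Suc 0) i w * A (Suc n) w j * R j)"
    using add[of i _ "Suc 0" "Suc n"] Suc.prems by (simp add: sum_distrib_right)
  also have "\<dots> = (\<Sum>w\<in>I. A (Suc 0) i w * (\<Sum>j\<in>I. A (Suc n) w j * R j))"
    by (subst sum.swap) (simp add: sum_distrib_left mult.assoc)
  also have "\<dots> = r ^ Suc n * (\<Sum>w\<in>I. A (Suc 0) i w * R w)"
    by (simp add: Suc.IH sum_distrib_left mult.left_commute)
  finally show ?case by (simp add: assms(1)[OF Suc.prems])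
qed (use assms in simp)

lemma is_PF_vector_limit: "is_PF_vector I (A (Suc 0)) limit"
  using sum_limit limit_pos
  by (simp add: is_PF_vector_def PF_eigenvalue_eq limit_eigenvector cong: sum.cong)
    (simp add: abs_of_pos)

text \<open>For every \<open>n\<close>, \<open>R i\<close> is the average of
  \<open>ratio i (Suc n) j\<close> with weights \<open>col (Suc n) j * R j / root ^ Suc n\<close>.
  Hence it lies between \<open>lo\<close> and \<open>hi\<close>, which share their limit. This is
  the uniqueness behind the description in \<open>PF_vector\<close>.\<close>

lemma PF_vector_unique:
  assumes "is_PF_vector I (A (Suc 0)) R" "i \<in> I"
  shows "R i = limit i"
proof -
  have R0: "\<And>i. i \<in> I \<Longrightarrow> R i > 0" and ev: "\<And>i. i \<in> I \<Longrightarrow> (\<Sum>j\<in>I. A (Suc 0) i j * R j) = root * R i"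
    and R1: "(\<Sum>i\<in>I. R i) = 1"
    using assms by (auto simp: is_PF_vector_def PF_eigenvalue_eq abs_of_pos cong: sum.cong)
  have total: "(\<Sum>j\<in>I. col (Suc n) j * R j) = root ^ Suc n" for n
  proof -
    have "(\<Sum>j\<in>I. col (Suc n) j * R j) = (\<Sum>i\<in>I. \<Sum>j\<in>I. A (Suc n) i j * R j)"
      unfolding col_def sum_distrib_right by (rule sum.swap)
    also have "\<dots> = root ^ Suc n * (\<Sum>i\<in>I. R i)"
      unfolding sum_distrib_left by (intro sum.cong refl eigenvector_power ev)
    finally show ?thesis by (simp add: R1)
  qed
  have pos: "root ^ Suc n > 0" for n
    unfolding total[symmetric] using finite_I I_ne
    by (intro sum_pos mult_pos_pos col_gt_0 R0) auto
  have row: "root ^ Suc n * R i = (\<Sum>j\<in>I. ratio i (Suc n) j * (col (Suc n) j * R j))" for n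
  proof -
    have "ratio i (Suc n) j * (col (Suc n) j * R j) = A (Suc n) i j * R j" if "j \<in> I" for j
      using col_gt_0[OF that, of "Suc n"] by (simp add: ratio_def)
    then have "(\<Sum>j\<in>I. ratio i (Suc n) j * (col (Suc n) j * R j)) = (\<Sum>j\<in>I. A (Suc n) i j * R j)"
      by (rule sum.cong[OF refl])
    then show ?thesis using eigenvector_power[OF ev assms(2), of n] by (simp only:)
  qed
  have nn: "col (Suc n) j * R j \<ge> 0" if "j \<in> I" for n j
    using col_gt_0[OF that] R0[OF that] by (simp add: less_imp_le)
  have "root ^ Suc n * lo i (Suc n) \<le> root ^ Suc n * R i" for n
    unfolding row unfolding total[symmetric] sum_distrib_right
    by (intro sum_mono) (simp add: mult.commute[of _ "lo i _"] mult_right_mono lo_le nn)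
  then have lower: "lo i (Suc n) \<le> R i" for n using pos[of n] mult_le_cancel_left_pos by blast
  have "root ^ Suc n * R i \<le> root ^ Suc n * hi i (Suc n)" for n
    unfolding row unfolding total[symmetric] sum_distrib_right
    by (intro sum_mono) (simp add: mult.commute[of _ "hi i _"] mult_right_mono le_hi nn)
  then have upper: "R i \<le> hi i (Suc n)" for n using pos[of n] mult_le_cancel_left_pos by blast
  have "limit i \<le> R i" using LIMSEQ_Suc[OF lo_tendsto[OF assms(2)]] lower
    by (intro LIMSEQ_le_const2) auto
  moreover have "R i \<le> limit i" using LIMSEQ_Suc[OF hi_tendsto[OF assms(2)]] upper
    by (intro LIMSEQ_le_const) auto
  ultimately show ?thesis by simp
qed

end

section \<open>Frequencies in expected images of letters\<close>

lemma occ_set_finite: "finite {k. k + length v \<le> length u \<and> take (length v) (drop k u) = v}"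
  by (rule finite_subset[of _ "{..length u}"]) auto

lemma occ_le_length:
  assumes "v \<noteq> []"
  shows "occ u v \<le> length u"
proof -
  have "occ u v \<le> card {..<length u}"
    unfolding occ_def using assms by (intro card_mono) (auto simp: neq_Nil_conv)
  then show ?thesis by simp
qed

lemma occ_append_ge:
  assumes "v \<noteq> []"
  shows "occ x v + occ y v \<le> occ (x @ y) v"
proof -
  let ?P = "\<lambda>u. {k. k + length v \<le> length u \<and> take (length v) (drop k u) = v}"
  have "occ x v + occ y v = card (?P x) + card ((+) (length x) ` ?P y)"
    by (simp add: occ_def card_image)
  also have "\<dots> = card (?P x \<union> (+) (length x) ` ?P y)"
    using assms by (subst card_Un_disjoint) (auto simp: occ_set_finite)
  also have "\<dots> \<le> occ (x @ y) v"
    unfolding occ_def by (intro card_mono occ_set_finite) auto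
  finally show ?thesis .
qed

lemma occ_append_le:
  assumes "v \<noteq> []"
  shows "occ (x @ y) v \<le> occ x v + occ y v + length v"
proof -
  let ?P = "\<lambda>u. {k. k + length v \<le> length u \<and> take (length v) (drop k u) = v}"
  \<comment> \<open>Starts of occurrences that cross the seam, fewer than \<open>length v\<close> in
    number; truncated subtraction covers the case where \<open>v\<close> is longer than
    \<open>x\<close>.\<close>
  let ?B = "{Suc (length x) - length v..<length x}"
  have "?P (x @ y) \<subseteq> ?P x \<union> (+) (length x) ` ?P y \<union> ?B"
  proof
    fix k assume k: "k \<in> ?P (x @ y)"
    consider "k + length v \<le> length x" | "k \<ge> length x" | "k \<in> ?B" by fastforce
    then show "k \<in> ?P x \<union> (+) (length x) ` ?P y \<union> ?B"
    proof cases
      case 2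
      then have "k = length x + (k - length x)" "k - length x \<in> ?P y" using k by auto
      then show ?thesis by blast
    qed (use k in auto)
  qed
  then have "occ (x @ y) v \<le> card (?P x \<union> (+) (length x) ` ?P y \<union> ?B)"
    unfolding occ_def by (intro card_mono) (auto simp: occ_set_finite)
  also have "\<dots> \<le> card (?P x) + card ((+) (length x) ` ?P y) + card ?B"
    by (meson card_Un_le add_le_mono order_refl order_trans)
  also have "\<dots> \<le> occ x v + occ y v + length v"
    by (simp add: occ_def card_image)
  finally show ?thesis .
qed

lemma occ_Nil [simp]: "v \<noteq> [] \<Longrightarrow> occ [] v = 0"
  using occ_le_length[of v "[]"] by simp

lemma occ_concat_ge: "v \<noteq> [] \<Longrightarrow> (\<Sum>w\<leftarrow>ws. occ w v) \<le> occ (concat ws) v"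
proof (induction ws)
  case (Cons w ws)
  then show ?case using occ_append_ge[of v w "concat ws"] by simp
qed simp

lemma occ_concat_le: "v \<noteq> [] \<Longrightarrow> occ (concat ws) v \<le> (\<Sum>w\<leftarrow>ws. occ w v + length v)"
proof (induction ws)
  case (Cons w ws)
  then show ?case using occ_append_le[of v w "concat ws"] by simp
qed simp

lemma occ_single: "occ w [a] = card {k. k < length w \<and> w ! k = a}"
proof -
  have "{k. k + length [a] \<le> length w \<and> take (length [a]) (drop k w) = [a]} = {k. k < length w \<and> w ! k = a}"
    by (auto simp: Suc_le_eq take_Suc_conv_app_nth hd_drop_conv_nth take_Suc)
  then show ?thesis by (simp only: occ_def)
qed

lemma occ_single_pos_iff: "occ w [a] > 0 \<longleftrightarrow> a \<in> set w"
  by (auto simp: occ_single card_gt_0_iff in_set_conv_nth)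

lemma subword_iff: "subword v u \<longleftrightarrow> (\<exists>p s. u = p @ v @ s)"
proof -
  have "subword v u \<longleftrightarrow> (\<exists>k. k + length v \<le> length u \<and> take (length v) (drop k u) = v)"
    using occ_set_finite[of v u] by (auto simp: subword_def occ_def Suc_le_eq card_gt_0_iff)
  also have "\<dots> \<longleftrightarrow> (\<exists>p s. u = p @ v @ s)"
  proof
    assume "\<exists>k. k + length v \<le> length u \<and> take (length v) (drop k u) = v"
    then obtain k where "take (length v) (drop k u) = v" by blast
    then have "u = take k u @ v @ drop (length v) (drop k u)"
      by (metis append_take_drop_id)
    then show "\<exists>p s. u = p @ v @ s" by blast
  next
    assume "\<exists>p s. u = p @ v @ s"
    then obtain p s where "u = p @ v @ s" by blast
    then show "\<exists>k. k + length v \<le> length u \<and> take (length v) (drop k u) = v"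
      by (intro exI[of _ "length p"]) auto
  qed
  finally show ?thesis .
qed

lemma sum_indicator_eq_card:
  "(\<Sum>k<n::nat. indicator {v} (f k) :: real) = real (card {k. k < n \<and> f k = v})"
proof -
  have "(\<Sum>k<n. indicator {v} (f k) :: real) = (\<Sum>k<n. of_bool (f k = v))"
    by (intro sum.cong) auto
  also have "\<dots> = real (card ({..<n} \<inter> {k. f k = v}))"
    by (simp add: sum_of_bool_eq)
  also have "{..<n} \<inter> {k. f k = v} = {k. k < n \<and> f k = v}" by auto
  finally show ?thesis .
qed

text \<open>At most \<open>length v\<close> windows starting in \<open>x\<close> run over into
  \<open>y\<close>. This boundary error separates an entry of the induced matrix from the mean count
  in the first block alone.\<close>

lemma window_sum_indicator:
  assumes "v \<noteq> []"
  shows "real (occ x v) \<le> window_sum (length v) (indicator {v}) x y"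
    and "window_sum (length v) (indicator {v}) x y \<le> real (occ x v) + length v"
proof -
  let ?P = "{k. k + length v \<le> length x \<and> take (length v) (drop k x) = v}"
  let ?W = "{k. k < length x \<and> take (length v) (drop k (x @ y)) = v}"
  have eq: "window_sum (length v) (indicator {v}) x y = real (card ?W)"
    unfolding window_sum_def by (rule sum_indicator_eq_card)
  have "?P \<subseteq> ?W" using assms by (auto simp: neq_Nil_conv)
  then have "card ?P \<le> card ?W" by (intro card_mono) auto
  then show "real (occ x v) \<le> window_sum (length v) (indicator {v}) x y"
    by (simp add: eq occ_def)
  have "?W \<subseteq> ?P \<union> {Suc (length x) - length v..<length x}"
    by fastforce
  then have "card ?W \<le> card (?P \<union> {Suc (length x) - length v..<length x})"
    by (intro card_mono) (auto simp: occ_set_finite)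
  also have "\<dots> \<le> card ?P + card {Suc (length x) - length v..<length x}" by (rule card_Un_le)
  also have "\<dots> \<le> occ x v + length v" by (simp add: occ_def)
  finally show "window_sum (length v) (indicator {v}) x y \<le> real (occ x v) + length v"
    unfolding eq by linarith
qed

lemma induced_matrix_eq_transfer:
  assumes "v \<noteq> []"
  shows "induced_matrix \<phi> l u v = transfer \<phi> l (indicator {u}) v"
proof -
  have "real (occ (map (\<lambda>k. take l (drop k (concat ws))) [0..<length (hd ws)]) [u]) =
      window_sum l (indicator {u}) (hd ws) (concat (tl ws))"
    if "ws \<in> set_pmf (subst_pieces \<phi> v)" for ws
  proof -
    have ws: "hd ws @ concat (tl ws) = concat ws"
      using that assms by (cases ws) (auto simp: set_subst_pieces)
    have "window_sum l (indicator {u}) (hd ws) (concat (tl ws)) =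
        real (card {k. k < length (hd ws) \<and> take l (drop k (concat ws)) = u})"
      unfolding window_sum_def ws by (rule sum_indicator_eq_card)
    also have "{k. k < length (hd ws) \<and> take l (drop k (concat ws)) = u} =
       {k. k < length (map (\<lambda>k. take l (drop k (concat ws))) [0..<length (hd ws)]) \<and>
          map (\<lambda>k. take l (drop k (concat ws))) [0..<length (hd ws)] ! k = u}"
      by auto
    finally show ?thesis by (simp only: occ_single)
  qed
  then show ?thesis
    unfolding induced_matrix_def transfer_def induced_subst_def integral_map_pmf
    by (rule expect_cong)
qed

lemma expect_length_subst_word:
  assumes "random_substitution \<phi>"
  shows "expect (subst_word \<phi> w) (\<lambda>x. real (length x)) =
    (\<Sum>c\<leftarrow>w. expect (\<phi> c) (\<lambda>x. real (length x)))"
proof (induction w)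
  case (Cons c w)
  have "expect (subst_word \<phi> ([c] @ w)) (\<lambda>x. real (length x)) =
    expect (\<phi> c) (\<lambda>x. real (length x)) + (\<Sum>c\<leftarrow>w. expect (\<phi> c) (\<lambda>x. real (length x)))"
    by (simp only: expect_subst_word_append[OF assms])
      (simp add: expect_add finite_subst_word[OF assms] random_substitutionD[OF assms] Cons)
  then show ?case by simp
qed simp

section \<open>Letters reached by iterates and growth of mean lengths\<close>

locale primitive_expanding =
  fixes \<theta> :: "'a::finite \<Rightarrow> 'a list pmf"
  assumes subst: "random_substitution \<theta>"
    and primitive: "primitive_subst \<theta>"
    and expanding: "expanding_subst \<theta>"
begin

abbreviation pow :: "nat \<Rightarrow> 'a \<Rightarrow> 'a list pmf" where "pow \<equiv> subst_power \<theta>"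

lemma subst_pow: "random_substitution (pow n)"
  by (rule random_substitution_power[OF subst])

lemmas finite_pow = random_substitutionD(1)[OF subst_pow]
lemmas finite_subst_word_pow = finite_subst_word[OF subst_pow]

lemma pow_nonempty: "\<exists>c w. c # w \<in> set_pmf (pow n a)"
  using random_substitutionD(2)[OF subst_pow] set_pmf_not_empty[of "pow n a"]
  by (metis ex_in_conv neq_Nil_conv)

lemma set_pow_add: "set_pmf (pow (m + n) a) = (\<Union>w\<in>set_pmf (pow m a). set_pmf (subst_word (pow n) w))"
  by (simp add: subst_power_add)

lemma set_subst_word_infix:
  assumes "x \<in> set_pmf (subst_word \<phi> u)"
  shows "\<exists>p' s'. p' @ x @ s' \<in> set_pmf (subst_word \<phi> (p @ u @ s))"
proof -
  obtain p' s' where "p' \<in> set_pmf (subst_word \<phi> p)" "s' \<in> set_pmf (subst_word \<phi> s)"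
    using set_pmf_not_empty by (metis ex_in_conv)
  then show ?thesis using assms by (auto simp: set_subst_word_append intro!: exI)
qed

text \<open>Passes from means to realisations: a nonzero entry of a matrix product goes through some
  letter \<open>c\<close>, and a nonzero mean count requires an image that contains the
  letter.\<close>

lemma matrix_power_reach:
  assumes "(((**) (subst_matrix \<theta>) ^^ k) (mat 1)) $ a $ b \<noteq> 0"
  shows "\<exists>w\<in>set_pmf (pow k b). a \<in> set w"
  using assms
proof (induction k arbitrary: a)
  case 0
  then show ?case by (auto simp: subst_power_0 mat_def split: if_splits)
next
  case (Suc k)
  define X where "X = ((**) (subst_matrix \<theta>) ^^ k) (mat 1)"
  have "(subst_matrix \<theta> ** X) $ a $ b \<noteq> 0" using Suc.prems by (simp add: X_def)
  then have "(\<Sum>c\<in>UNIV. subst_matrix \<theta> $ a $ c * X $ c $ b) \<noteq> 0"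
    by (simp add: matrix_matrix_mult_def)
  then obtain c where "subst_matrix \<theta> $ a $ c * X $ c $ b \<noteq> 0"
    by (rule sum.not_neutral_contains_not_neutral)
  then have c: "subst_matrix \<theta> $ a $ c \<noteq> 0" "(((**) (subst_matrix \<theta>) ^^ k) (mat 1)) $ c $ b \<noteq> 0"
    by (auto simp: X_def)
  obtain w where w: "w \<in> set_pmf (\<theta> c)" "a \<in> set w"
  proof (rule ccontr)
    assume *: "\<not> thesis"
    have "expect (\<theta> c) (\<lambda>w. real (occ w [a])) = expect (\<theta> c) (\<lambda>_. 0)"
      using * that occ_single_pos_iff by (intro expect_cong) fastforce
    then show False using c(1) by (simp add: subst_matrix_def)
  qed
  obtain z where z: "z \<in> set_pmf (pow k b)" "c \<in> set z" using Suc.IH[OF c(2)] by blast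
  then obtain p s where "z = p @ [c] @ s" by (metis split_list append_Cons append_Nil)
  then obtain p' s' where "p' @ w @ s' \<in> set_pmf (subst_word \<theta> z)"
    using set_subst_word_infix[of w \<theta> "[c]" p s] w by auto
  then have "p' @ w @ s' \<in> set_pmf (pow (Suc k) b)"
    using z set_pow_add[of k "Suc 0" b] by auto
  then show ?case using w by (intro bexI) auto
qed

text \<open>Positivity at the single time \<open>k\<close> persists: the first \<open>n - k\<close>
  steps produce some letter, and \<open>k\<close> further steps lead from it to any other.\<close>

lemma reach: "\<exists>k. \<forall>n\<ge>k. \<forall>a b. \<exists>w\<in>set_pmf (pow n b). a \<in> set w"
proof -
  obtain k where k: "\<And>a b. (((**) (subst_matrix \<theta>) ^^ k) (mat 1)) $ a $ b > 0"
    using primitive by (auto simp: primitive_subst_def primitive_matrix_def)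
  have "\<exists>w\<in>set_pmf (pow n b). a \<in> set w" if n: "n \<ge> k" for n a b
  proof -
    obtain c w where w: "c # w \<in> set_pmf (pow (n - k) b)" using pow_nonempty by blast
    obtain z where z: "z \<in> set_pmf (pow k c)" "a \<in> set z"
      using matrix_power_reach k by (metis less_irrefl)
    obtain p' s' where "p' @ z @ s' \<in> set_pmf (subst_word (pow k) (c # w))"
      using set_subst_word_infix[of z "pow k" "[c]" "[]" w] z by auto
    then have "p' @ z @ s' \<in> set_pmf (pow n b)"
      using w set_pow_add[of "n - k" k b] n by auto
    then show ?thesis using z by (intro bexI) auto
  qed
  then show ?thesis by blast
qed

definition len :: "nat \<Rightarrow> 'a \<Rightarrow> real" where
  "len n a = expect (pow n a) (\<lambda>w. real (length w))"

lemma len_ge_1: "len n a \<ge> 1"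
proof -
  have "len n a \<ge> expect (pow n a) (\<lambda>_. 1)"
    unfolding len_def using random_substitutionD(2)[OF subst_pow]
    by (intro expect_mono finite_pow) (auto simp: Suc_le_eq)
  then show ?thesis by simp
qed

lemma len_add: "len (m + n) a = expect (pow m a) (\<lambda>w. \<Sum>c\<leftarrow>w. len n c)"
  by (simp add: len_def subst_power_add expect_bind finite_pow finite_subst_word_pow
      expect_length_subst_word subst_pow)

lemma sum_list_ge_length: "(\<And>c. f c \<ge> q) \<Longrightarrow> q * real (length w) \<le> (\<Sum>c\<leftarrow>w. f c)"
  by (induction w) (auto simp: algebra_simps intro: add_mono)

lemma len_mult_le: "(\<And>c. len n c \<ge> q) \<Longrightarrow> q * len m a \<le> len (m + n) a"
proof -
  assume "\<And>c. len n c \<ge> q"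
  then have "expect (pow m a) (\<lambda>w. q * real (length w)) \<le> len (m + n) a"
    unfolding len_add by (intro expect_mono finite_pow sum_list_ge_length)
  then show ?thesis by (simp add: len_def)
qed

lemma len_mono: "m \<le> n \<Longrightarrow> len m a \<le> len n a"
  using len_mult_le[of 1 "n - m" m a] len_ge_1 by simp

lemma len_1_gt: "\<exists>x. len 1 x > 1"
proof -
  obtain x where "measure_pmf.prob (\<theta> x) {w. length w > 1} > 0"
    using expanding by (auto simp: expanding_subst_def)
  then have "set_pmf (\<theta> x) \<inter> {w. length w > 1} \<noteq> {}"
    using measure_pmf_zero_iff[of "\<theta> x" "{w. length w > 1}"] by auto
  then obtain w where w: "w \<in> set_pmf (\<theta> x)" "length w > 1" by auto
  have "expect (\<theta> x) (\<lambda>w. real (length w) - 1) > 0"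
    using w random_substitutionD[OF subst]
    by (intro expect_pos[where x = w]) (auto simp: Suc_le_eq)
  then show ?thesis
    by (auto simp: len_def expect_diff random_substitutionD[OF subst] intro!: exI[of _ x])
qed

text \<open>The expanding letter \<open>x\<close> occurs with positive probability in the
  \<open>k\<close>-th iterate of every letter. One further step lengthens it in mean, and no letter
  ever shrinks.\<close>

lemma len_uniform_gt: "\<exists>K. \<forall>a. len K a > 1"
proof -
  obtain x where x: "len 1 x > 1" using len_1_gt by blast
  obtain k where k: "\<And>a b. \<exists>w\<in>set_pmf (pow k b). a \<in> set w" using reach by blast
  have "len (k + 1) a > 1" for a
  proof -
    obtain w where w: "w \<in> set_pmf (pow k a)" "x \<in> set w" using k by blast
    have "expect (pow k a) (\<lambda>w. \<Sum>c\<leftarrow>w. (len 1 c - 1)) > 0"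
    proof (rule expect_pos[where x = w])
      show "(\<Sum>c\<leftarrow>u. (len 1 c - 1)) \<ge> 0" for u
        using len_ge_1[of 1] by (intro sum_list_nonneg) auto
      obtain p s where "w = p @ x # s" using w by (meson split_list)
      moreover have "(\<Sum>c\<leftarrow>u. (len 1 c - 1)) \<ge> 0" for u
        using len_ge_1[of 1] by (intro sum_list_nonneg) auto
      ultimately show "(\<Sum>c\<leftarrow>w. (len 1 c - 1)) > 0"
        using x by (simp add: add_nonneg_pos add_pos_nonneg)
    qed (use w finite_pow in auto)
    also have "expect (pow k a) (\<lambda>w. \<Sum>c\<leftarrow>w. (len 1 c - 1)) = len (k + 1) a - len k a"
      unfolding len_add sum_list_subtractf expect_diff[OF finite_pow]
      by (simp add: sum_list_triv len_def)
    finally show ?thesis using len_ge_1[of k a] by linarith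
  qed
  then show ?thesis by blast
qed

text \<open>The least mean length \<open>q\<close> at time \<open>K\<close> exceeds 1 because the
  alphabet is finite. Mean lengths grow by a factor of at least \<open>q\<close> every
  \<open>K\<close> steps, and monotonicity covers the times in between.\<close>

lemma len_at_top: "\<exists>N. \<forall>n\<ge>N. \<forall>a. len n a \<ge> C"
proof -
  obtain K where K: "\<And>a. len K a > 1" using len_uniform_gt by blast
  define q where "q = Min (range (len K))"
  have q: "q \<le> len K a" for a by (simp add: q_def)
  have "q \<in> range (len K)" unfolding q_def by (intro Min_in) auto
  then have q1: "q > 1" using K by auto
  have pw: "q ^ j \<le> len (j * K) a" for j a
  proof (induction j)
    case 0
    then show ?case using len_ge_1 by simp
  next
    case (Suc j)
    have "q ^ Suc j \<le> q * len (j * K) a" using Suc q1 by simp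
    also have "\<dots> \<le> len (j * K + K) a" by (intro len_mult_le q)
    finally show ?case by (simp add: add.commute)
  qed
  obtain j where "C < q ^ j" using real_arch_pow[OF q1] by blast
  then have "C \<le> len n a" if "n \<ge> j * K" for n a
    using pw[of j a] len_mono[OF that, of a] by linarith
  then show ?thesis by blast
qed

section \<open>Legal words and the induced matrices of iterates\<close>

lemma language_iff: "u \<in> language \<theta> \<longleftrightarrow> u \<noteq> [] \<and> (\<exists>n a p s. p @ u @ s \<in> set_pmf (pow n a))"
  unfolding language_def subword_iff subst_power_def pmf_positive_iff by blast

lemma language_infix: "p @ u @ s \<in> language \<theta> \<Longrightarrow> u \<noteq> [] \<Longrightarrow> u \<in> language \<theta>"
  unfolding language_iff by (metis append.assoc)

lemma language_image:
  assumes "u \<in> language \<theta>" "x \<in> set_pmf (subst_word (pow n) u)"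
  shows "x \<in> language \<theta>"
proof -
  obtain m a p s where u: "u \<noteq> []" "p @ u @ s \<in> set_pmf (pow m a)"
    using assms by (auto simp: language_iff)
  obtain p' s' where "p' @ x @ s' \<in> set_pmf (subst_word (pow n) (p @ u @ s))"
    using set_subst_word_infix[OF assms(2)] by blast
  then have "p' @ x @ s' \<in> set_pmf (pow (m + n) a)" using u by (auto simp: set_pow_add)
  moreover have "x \<noteq> []" using length_subst_word[OF subst_pow assms(2)] u by auto
  ultimately show ?thesis by (auto simp: language_iff)
qed

text \<open>The \<open>l - 1\<close> letters of \<open>u\<close> have nonempty images, so a window
  starting in \<open>x\<close> is never cut short.\<close>

lemma legal_window:
  assumes "c # u \<in> legal_words \<theta> l" "x \<in> set_pmf (pow n c)" "y \<in> set_pmf (subst_word (pow n) u)"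
    "k < length x"
  shows "take l (drop k (x @ y)) \<in> legal_words \<theta> l"
proof -
  have "x @ y \<in> set_pmf (subst_word (pow n) ([c] @ u))"
    using assms by (subst set_subst_word_append) auto
  then have "x @ y \<in> language \<theta>"
    using assms(1) language_image[of "c # u"] by (auto simp: legal_words_def)
  then have "take k (x @ y) @ take l (drop k (x @ y)) @ drop l (drop k (x @ y)) \<in> language \<theta>"
    by (simp only: append_take_drop_id)
  moreover have len: "length (take l (drop k (x @ y))) = l"
    using length_subst_word[OF subst_pow assms(3)] assms(1,4) by (auto simp: legal_words_def)
  moreover have "take l (drop k (x @ y)) \<noteq> []"
    using len assms(1) by (auto simp: legal_words_def)
  ultimately show ?thesis
    unfolding legal_words_def by (blast intro: language_infix)
qed

lemma finite_legal: "finite (legal_words \<theta> l)"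
  by (rule finite_subset[OF _ finite_lists_length_eq[of "UNIV :: 'a set" l]]) (auto simp: legal_words_def)

lemma legal_nonempty: "u \<in> legal_words \<theta> l \<Longrightarrow> u \<noteq> []"
  by (auto simp: legal_words_def language_def)

lemma legal_length: "u \<in> legal_words \<theta> l \<Longrightarrow> length u = l"
  by (auto simp: legal_words_def)

text \<open>Unbounded mean lengths give a realisation \<open>c # z\<close> with at least
  \<open>l\<close> letters after \<open>c\<close>. An iterate of \<open>c\<close> can contain
  \<open>a\<close>, and the image of \<open>z\<close> leaves enough letters behind it. Columns
  indexed by words thus provide information about every letter.\<close>

lemma legal_starting_with: "\<exists>u. a # u \<in> legal_words \<theta> (Suc l)"
proof -
  obtain n where n: "\<And>b. len n b \<ge> real (Suc l)" using len_at_top by blast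
  fix b :: 'a
  obtain w where w: "w \<in> set_pmf (pow n b)" "length w \<ge> Suc l"
  proof (rule ccontr)
    assume *: "\<not> thesis"
    have "len n b \<le> expect (pow n b) (\<lambda>_. real l)"
      unfolding len_def using * that by (intro expect_mono finite_pow) fastforce
    then show False using n[of b] by simp
  qed
  then obtain c z where z: "w = c # z" "length z \<ge> l" by (cases w) auto
  obtain k where k: "\<And>a b. \<exists>w\<in>set_pmf (pow k b). a \<in> set w" using reach by blast
  obtain x where x: "x \<in> set_pmf (pow k c)" "a \<in> set x" using k by blast
  then obtain p s where ps: "x = p @ a # s" by (meson split_list)
  obtain y where y: "y \<in> set_pmf (subst_word (pow k) z)" using set_pmf_not_empty by (metis ex_in_conv)
  have "x @ y \<in> set_pmf (subst_word (pow k) ([c] @ z))"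
    using x y by (subst set_subst_word_append) auto
  then have "x @ y \<in> set_pmf (pow (n + k) b)" using w z by (auto simp: set_pow_add)
  then have "p @ (a # take l (s @ y)) @ drop l (s @ y) \<in> set_pmf (pow (n + k) b)"
    by (simp add: ps del: take_append drop_append)
  then have "a # take l (s @ y) \<in> language \<theta>" unfolding language_iff by blast
  moreover have "length (take l (s @ y)) = l"
    using length_subst_word[OF subst_pow y] z by simp
  ultimately show ?thesis by (auto simp: legal_words_def)
qed

lemma transfer_legal_cong:
  assumes "u \<in> legal_words \<theta> l" "\<And>w. w \<in> legal_words \<theta> l \<Longrightarrow> g w = h w"
  shows "transfer (pow n) l g u = transfer (pow n) l h u"
proof -
  obtain c u' where u: "u = c # u'" using legal_nonempty[OF assms(1)] by (cases u) auto
  show ?thesis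
    unfolding u transfer_Cons[OF subst_pow] window_sum_def
    using assms legal_window by (intro expect_cong sum.cong refl) (auto simp: u)
qed

lemma transfer_sum:
  assumes "u \<noteq> []"
  shows "transfer (pow n) l (\<lambda>w. \<Sum>i\<in>I. c i * g i w) u = (\<Sum>i\<in>I. c i * transfer (pow n) l (g i) u)"
proof -
  have "window_sum l (\<lambda>w. \<Sum>i\<in>I. c i * g i w) x y = (\<Sum>i\<in>I. c i * window_sum l (g i) x y)" for x y :: "'a list"
    by (simp add: window_sum_def sum_distrib_left sum.swap[of _ I])
  then show ?thesis
    unfolding transfer_def by (simp add: expect_sum finite_subst_pieces[OF subst_pow])
qed

lemma transfer_expand:
  assumes "u \<in> legal_words \<theta> l"
  shows "transfer (pow n) l g u = (\<Sum>i\<in>legal_words \<theta> l. g i * induced_matrix (pow n) l i u)"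
proof -
  note ne = legal_nonempty[OF assms]
  have "transfer (pow n) l g u =
      transfer (pow n) l (\<lambda>w. \<Sum>i\<in>legal_words \<theta> l. g i * indicator {i} w) u"
    using finite_legal by (intro transfer_legal_cong[OF assms]) (simp add: indicator_def)
  then show ?thesis by (simp add: transfer_sum[OF ne] induced_matrix_eq_transfer[OF ne])
qed

text \<open>Each position in the first image starts exactly one window, so column sums of the
  induced matrix are mean lengths, whatever \<open>l\<close> is.\<close>

lemma transfer_one: "transfer (pow n) l (\<lambda>_. 1) (a # u) = len n a"
  by (simp add: transfer_Cons[OF subst_pow] window_sum_def len_def)

lemma transfer_nonneg: "(\<And>w. g w \<ge> 0) \<Longrightarrow> transfer \<phi> l g u \<ge> 0"
  unfolding transfer_def window_sum_def by (intro expect_nonneg sum_nonneg) auto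

lemma expect_occ_le_transfer:
  assumes "v \<noteq> []"
  shows "expect (pow n a) (\<lambda>x. real (occ x v)) \<le> transfer (pow n) (length v) (indicator {v}) (a # u)"
    and "transfer (pow n) (length v) (indicator {v}) (a # u) \<le> expect (pow n a) (\<lambda>x. real (occ x v)) + length v"
proof -
  have "expect (pow n a) (\<lambda>x. real (occ x v)) = expect (pow n a) (\<lambda>x. expect (subst_word (pow n) u) (\<lambda>_. real (occ x v)))"
    by simp
  also have "\<dots> \<le> transfer (pow n) (length v) (indicator {v}) (a # u)"
    unfolding transfer_Cons[OF subst_pow]
    by (intro expect_mono finite_pow finite_subst_word_pow window_sum_indicator assms)
  finally show "expect (pow n a) (\<lambda>x. real (occ x v)) \<le> transfer (pow n) (length v) (indicator {v}) (a # u)" .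
  have "transfer (pow n) (length v) (indicator {v}) (a # u) \<le>
      expect (pow n a) (\<lambda>x. expect (subst_word (pow n) u) (\<lambda>_. real (occ x v) + length v))"
    unfolding transfer_Cons[OF subst_pow]
    by (intro expect_mono finite_pow finite_subst_word_pow window_sum_indicator assms)
  also have "\<dots> = expect (pow n a) (\<lambda>x. real (occ x v)) + length v"
    by (simp add: expect_add finite_pow)
  finally show "transfer (pow n) (length v) (indicator {v}) (a # u) \<le> expect (pow n a) (\<lambda>x. real (occ x v)) + length v" .
qed

text \<open>Each legal word \<open>u\<close> occurs in the \<open>N u\<close>-th iterate of some
  letter. There are finitely many such words, so \<open>K\<close> exceeds every \<open>N u\<close>
  by at least the time \<open>k\<close> after which that letter is reachable from any starting
  letter.\<close>

lemma induced_primitive: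
  "\<exists>k. \<forall>u\<in>legal_words \<theta> l. \<forall>v\<in>legal_words \<theta> l. induced_matrix (pow k) l u v > 0"
proof -
  obtain k where k: "\<And>n a b. n \<ge> k \<Longrightarrow> \<exists>w\<in>set_pmf (pow n b). a \<in> set w" using reach by blast
  have "\<exists>n. \<exists>a p s. p @ u @ s \<in> set_pmf (pow n a)" if "u \<in> legal_words \<theta> l" for u
    using that by (auto simp: legal_words_def language_iff)
  then obtain N where N: "\<And>u. u \<in> legal_words \<theta> l \<Longrightarrow> \<exists>a p s. p @ u @ s \<in> set_pmf (pow (N u) a)"
    by metis
  define K where "K = k + (\<Sum>u\<in>legal_words \<theta> l. N u)"
  have "induced_matrix (pow K) l u v > 0" if u: "u \<in> legal_words \<theta> l" and v: "v \<in> legal_words \<theta> l" for u v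
  proof -
    obtain b v' where v': "v = b # v'" using legal_nonempty[OF v] by (cases v) auto
    have "N u \<le> (\<Sum>u\<in>legal_words \<theta> l. N u)" using u finite_legal by (intro member_le_sum) auto
    then have NK: "K - N u \<ge> k" "K = (K - N u) + N u" by (auto simp: K_def)
    obtain a p s where aps: "p @ u @ s \<in> set_pmf (pow (N u) a)" using N[OF u] by blast
    obtain w where w: "w \<in> set_pmf (pow (K - N u) b)" "a \<in> set w" using k[OF NK(1)] by blast
    then obtain q r where "w = q @ [a] @ r" by (metis split_list append_Cons append_Nil)
    then obtain q' r' where "q' @ (p @ u @ s) @ r' \<in> set_pmf (subst_word (pow (N u)) w)"
      using set_subst_word_infix[of "p @ u @ s" "pow (N u)" "[a]" q r] aps by auto
    then have y: "q' @ (p @ u @ s) @ r' \<in> set_pmf (pow K b)"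
      using w by (subst NK(2), subst set_pow_add) auto
    have "subword u (q' @ (p @ u @ s) @ r')" unfolding subword_iff by (metis append.assoc)
    then have "occ (q' @ (p @ u @ s) @ r') u > 0" by (simp add: subword_def)
    then have "expect (pow K b) (\<lambda>x. real (occ x u)) > 0"
      using y by (intro expect_pos[where x = "q' @ (p @ u @ s) @ r'"] finite_pow) auto
    also have "\<dots> \<le> induced_matrix (pow K) l u v"
      using expect_occ_le_transfer(1)[OF legal_nonempty[OF u], of K b v'] legal_length[OF u]
      by (simp add: induced_matrix_eq_transfer v')
    finally show ?thesis .
  qed
  then show ?thesis by blast
qed

lemma positive_semigroup_induced:
  assumes "l > 0"
  shows "\<exists>k. positive_semigroup (legal_words \<theta> l) (\<lambda>n. induced_matrix (pow n) l) k"
proof -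
  obtain k where k: "\<forall>u\<in>legal_words \<theta> l. \<forall>v\<in>legal_words \<theta> l. induced_matrix (pow k) l u v > 0"
    using induced_primitive by blast
  have "positive_semigroup (legal_words \<theta> l) (\<lambda>n. induced_matrix (pow n) l) k"
  proof
    show "finite (legal_words \<theta> l)" by (rule finite_legal)
    show "legal_words \<theta> l \<noteq> {}" using legal_starting_with[of _ "l - 1"] assms by auto
    show "induced_matrix (pow n) l i j \<ge> 0" if "j \<in> legal_words \<theta> l" for n i j
      using legal_nonempty[OF that] by (simp add: induced_matrix_eq_transfer transfer_nonneg)
    show "induced_matrix (pow (m + n)) l i j =
        (\<Sum>w\<in>legal_words \<theta> l. induced_matrix (pow m) l i w * induced_matrix (pow n) l w j)"
      if "j \<in> legal_words \<theta> l" for m n i j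
    proof -
      \<comment> \<open>Transposition reverses products, so the two exponents are exchanged before
        the transfer operators are composed.\<close>
      have "induced_matrix (pow (m + n)) l i j = transfer (pow (n + m)) l (indicator {i}) j"
        by (simp add: induced_matrix_eq_transfer[OF legal_nonempty[OF that]] add.commute)
      also have "\<dots> = transfer (pow n) l (transfer (pow m) l (indicator {i})) j"
        using that by (intro transfer_power_add subst legal_length legal_nonempty)
      also have "\<dots> = (\<Sum>w\<in>legal_words \<theta> l. transfer (pow m) l (indicator {i}) w * induced_matrix (pow n) l w j)"
        by (rule transfer_expand[OF that])
      also have "\<dots> = (\<Sum>w\<in>legal_words \<theta> l. induced_matrix (pow m) l i w * induced_matrix (pow n) l w j)"
        by (intro sum.cong refl) (simp add: induced_matrix_eq_transfer legal_nonempty)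
      finally show ?thesis .
    qed
    show "(\<Sum>i\<in>legal_words \<theta> l. induced_matrix (pow n) l i j) > 0" if j: "j \<in> legal_words \<theta> l" for n j
    proof -
      obtain b j' where "j = b # j'" using legal_nonempty[OF j] by (cases j) auto
      then have "(\<Sum>i\<in>legal_words \<theta> l. induced_matrix (pow n) l i j) = len n b"
        using transfer_expand[OF j, of n "\<lambda>_. 1"] by (simp add: transfer_one)
      then show ?thesis using len_ge_1[of n b] by simp
    qed
  qed (use k in auto)
  then show ?thesis by blast
qed

lemma is_PF_vector_PF_vector:
  assumes "l > 0"
  shows "is_PF_vector (legal_words \<theta> l) (induced_matrix \<theta> l) (PF_vector \<theta> l)"
    and "u \<in> legal_words \<theta> l \<Longrightarrow> v \<in> legal_words \<theta> l \<Longrightarrow>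
      (\<lambda>n. induced_matrix (pow n) l v u / (\<Sum>i\<in>legal_words \<theta> l. induced_matrix (pow n) l i u))
        \<longlonglongrightarrow> PF_vector \<theta> l v"
proof -
  let ?I = "legal_words \<theta> l"
  obtain k where k: "positive_semigroup ?I (\<lambda>n. induced_matrix (pow n) l) k"
    using positive_semigroup_induced[OF assms] by blast
  interpret positive_semigroup ?I "\<lambda>n. induced_matrix (pow n) l" k by (rule k)
  define R where "R = (\<lambda>u. if u \<in> ?I then limit u else 0)"
  have R: "is_PF_vector ?I (induced_matrix \<theta> l) R"
    using is_PF_vector_limit by (simp add: is_PF_vector_def R_def cong: sum.cong)
  have "PF_vector \<theta> l = R"
    unfolding PF_vector_def
  proof (rule the_equality)
    show "is_PF_vector ?I (induced_matrix \<theta> l) R \<and> (\<forall>u. u \<notin> ?I \<longrightarrow> R u = 0)"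
      using R by (simp add: R_def)
    show "R' = R" if "is_PF_vector ?I (induced_matrix \<theta> l) R' \<and> (\<forall>u. u \<notin> ?I \<longrightarrow> R' u = 0)" for R'
      using that PF_vector_unique[of R'] by (auto simp: R_def fun_eq_iff)
  qed
  with R show "is_PF_vector ?I (induced_matrix \<theta> l) (PF_vector \<theta> l)" by simp
  show "(\<lambda>n. induced_matrix (pow n) l v u / (\<Sum>i\<in>?I. induced_matrix (pow n) l i u))
        \<longlonglongrightarrow> PF_vector \<theta> l v" if "u \<in> ?I" "v \<in> ?I"
    using ratio_tendsto[OF that(2,1)] that by (simp add: \<open>PF_vector \<theta> l = R\<close> R_def ratio_def col_def)
qed

text \<open>In the column of \<open>a # u\<close> the normalising sum is \<open>len n a\<close>,
  while the numerator differs from the mean count in the image of \<open>a\<close> by at most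
  \<open>l\<close>. As \<open>len n a\<close> diverges, the difference disappears.\<close>

lemma expected_frequency_tendsto:
  assumes v: "v \<in> legal_words \<theta> l"
  shows "(\<lambda>n. expect (pow n a) (\<lambda>x. real (occ x v)) / len n a) \<longlonglongrightarrow> PF_vector \<theta> l v"
proof -
  have l: "l > 0" "length v = l" using legal_nonempty[OF v] legal_length[OF v] by auto
  obtain u where u: "a # u \<in> legal_words \<theta> l"
    using legal_starting_with[of a "l - 1"] l by auto
  define A where "A n = induced_matrix (pow n) l v (a # u) / len n a" for n
  have A: "A \<longlonglongrightarrow> PF_vector \<theta> l v"
    using is_PF_vector_PF_vector(2)[OF l(1) u v] transfer_expand[OF u, of _ "\<lambda>_. 1"]
    by (simp add: A_def[abs_def] transfer_one)
  have "filterlim (\<lambda>n. len n a) at_top sequentially"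
    unfolding filterlim_at_top eventually_sequentially using len_at_top by blast
  then have "(\<lambda>n. real l / len n a) \<longlonglongrightarrow> 0"
    by (intro real_tendsto_divide_at_top[OF tendsto_const])
  then have B: "(\<lambda>n. A n - l / len n a) \<longlonglongrightarrow> PF_vector \<theta> l v"
    using tendsto_diff[OF A] by fastforce
  have pos: "len n a > 0" for n using len_ge_1[of n a] by simp
  have "expect (pow n a) (\<lambda>x. real (occ x v)) / len n a \<le> A n"
    "A n - l / len n a \<le> expect (pow n a) (\<lambda>x. real (occ x v)) / len n a" for n
    using expect_occ_le_transfer[OF legal_nonempty[OF v], of n a u] pos[of n] l
    by (simp_all add: A_def induced_matrix_eq_transfer diff_divide_distrib[symmetric] divide_right_mono)
  then show ?thesis by (intro tendsto_sandwich[OF _ _ B A]) auto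
qed

text \<open>The two sides are not symmetric: gluing blocks can create up to \<open>l\<close>
  occurrences at a seam, which the upper estimate has to pay for, but it destroys none.\<close>

lemma expected_drift:
  assumes v: "v \<in> legal_words \<theta> l" and "\<epsilon> > 0"
  shows "\<exists>n. \<forall>a. expect (pow n a) (\<lambda>x. real (occ x v)) + l < (PF_vector \<theta> l v + \<epsilon>) * len n a \<and>
     (PF_vector \<theta> l v - \<epsilon>) * len n a < expect (pow n a) (\<lambda>x. real (occ x v))"
proof -
  let ?R = "PF_vector \<theta> l v"
  have "\<forall>\<^sub>F n in sequentially. \<forall>a\<in>UNIV. dist (expect (pow n a) (\<lambda>x. real (occ x v)) / len n a) ?R < \<epsilon> / 2"
    using \<open>\<epsilon> > 0\<close> by (intro eventually_ball_finite ballI tendstoD[OF expected_frequency_tendsto[OF v]]) auto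
  \<comment> \<open>Half of the margin \<epsilon> covers the frequency error; for lengths this large
    the other half absorbs the seam cost \<open>l\<close>.\<close>
  moreover have "\<forall>\<^sub>F n in sequentially. \<forall>a. len n a \<ge> 2 * (l + 1) / \<epsilon>"
    unfolding eventually_sequentially by (rule len_at_top)
  ultimately have "\<forall>\<^sub>F n in sequentially. \<forall>a. 
      dist (expect (pow n a) (\<lambda>x. real (occ x v)) / len n a) ?R < \<epsilon> / 2 \<and> len n a \<ge> 2 * (l + 1) / \<epsilon>"
    by eventually_elim auto
  then obtain n where n: "\<And>a. dist (expect (pow n a) (\<lambda>x. real (occ x v)) / len n a) ?R < \<epsilon> / 2"
     "\<And>a. len n a \<ge> 2 * (l + 1) / \<epsilon>"
    unfolding eventually_sequentially by blast
  have "expect (pow n a) (\<lambda>x. real (occ x v)) + l < (?R + \<epsilon>) * len n a \<and>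
     (?R - \<epsilon>) * len n a < expect (pow n a) (\<lambda>x. real (occ x v))" for a
  proof -
    let ?e = "expect (pow n a) (\<lambda>x. real (occ x v))"
    have pos: "len n a > 0" using len_ge_1[of n a] by simp
    have "\<bar>?e / len n a - ?R\<bar> < \<epsilon> / 2" using n(1)[of a] by (simp add: dist_real_def)
    then have "?e / len n a < ?R + \<epsilon> / 2" "?R - \<epsilon> / 2 < ?e / len n a" by linarith+
    then have e: "?e < (?R + \<epsilon> / 2) * len n a" "(?R - \<epsilon> / 2) * len n a < ?e"
      using pos by (simp_all add: divide_less_eq less_divide_eq)
    have "real l + 1 \<le> \<epsilon> / 2 * len n a"
      using n(2)[of a] \<open>\<epsilon> > 0\<close> by (simp add: field_simps)
    moreover have "\<epsilon> / 2 * len n a > 0" using \<open>\<epsilon> > 0\<close> pos by simp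
    ultimately show ?thesis using e by (simp add: algebra_simps)
  qed
  then show ?thesis by blast
qed

end

section \<open>Exponential deviation bounds\<close>

lemma exp_le_quadratic:
  fixes x :: real
  assumes "\<bar>x\<bar> \<le> 1"
  shows "exp x \<le> 1 + x + x\<^sup>2"
proof (cases "x \<ge> 0")
  case True
  then show ?thesis using assms exp_bound[of x] by simp
next
  case False
  define y where "y = - x"
  have y: "0 \<le> y" "y \<le> 1" using False assms by (auto simp: y_def)
  \<comment> \<open>For negative arguments, the claim follows once the product with the quadratic
    Taylor minorant of \<open>exp y\<close> is at least 1.\<close>
  have "(1 - y + y\<^sup>2) * (1 + y + y\<^sup>2 / 2) = 1 + y\<^sup>2 / 2 + y ^ 3 / 2 + y ^ 4 / 2"
    by (simp add: field_simps power2_eq_square power3_eq_cube power4_eq_xxxx)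
  then have "1 \<le> (1 - y + y\<^sup>2) * (1 + y + y\<^sup>2 / 2)" using y by simp
  also have "\<dots> \<le> (1 - y + y\<^sup>2) * exp y"
    using y exp_lower_Taylor_quadratic[of y] by (intro mult_left_mono) auto
  finally have "exp (- y) \<le> 1 - y + y\<^sup>2"
    by (simp add: exp_minus field_simps)
  then show ?thesis by (simp add: y_def)
qed

lemma exponential_moment_le_1:
  fixes \<phi> :: "'a::finite \<Rightarrow> 'b pmf" and Y :: "'b \<Rightarrow> real"
  assumes fin: "\<And>a. finite (set_pmf (\<phi> a))" and neg: "\<And>a. expect (\<phi> a) Y < 0"
  shows "\<exists>t0>0. \<forall>t. 0 < t \<longrightarrow> t \<le> t0 \<longrightarrow> (\<forall>a. expect (\<phi> a) (\<lambda>x. exp (t * Y x)) \<le> 1)"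
proof -
  define S where "S = (\<Union>a. set_pmf (\<phi> a))"
  define b where "b = Max (insert 1 ((\<lambda>x. \<bar>Y x\<bar>) ` S))"
  have S: "finite S" using fin by (simp add: S_def)
  then have b: "b \<ge> 1" "\<And>a x. x \<in> set_pmf (\<phi> a) \<Longrightarrow> \<bar>Y x\<bar> \<le> b"
    by (auto simp: b_def S_def intro!: Max_ge)
  define \<eta> where "\<eta> = Min (range (\<lambda>a. - expect (\<phi> a) Y))"
  have \<eta>: "\<eta> \<le> - expect (\<phi> a) Y" for a by (simp add: \<eta>_def)
  have "\<eta> \<in> range (\<lambda>a. - expect (\<phi> a) Y)" unfolding \<eta>_def by (intro Min_in) auto
  then have \<eta>0: "\<eta> > 0" using neg by auto
  \<comment> \<open>The 1 in the minimum, with \<open>b \<ge> 1\<close>, keeps the exponent in the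
    range of \<open>exp_le_quadratic\<close>; the \<eta> makes the linear term win.\<close>
  have "expect (\<phi> a) (\<lambda>x. exp (t * Y x)) \<le> 1" if t: "0 < t" "t \<le> min 1 \<eta> / b\<^sup>2" for t a
  proof -
    have tb: "t * b\<^sup>2 \<le> 1" "t * b\<^sup>2 \<le> \<eta>" using t b by (simp_all add: field_simps)
    have "t * b \<le> t * b\<^sup>2" using t b by (simp add: power2_eq_square)
    then have tb1: "t * b \<le> 1" using tb by simp
    have pt: "exp (t * Y x) \<le> 1 + t * (Y x + t * b\<^sup>2)" if "x \<in> set_pmf (\<phi> a)" for x
    proof -
      have "\<bar>t * Y x\<bar> \<le> t * b" using t b(2)[OF that] by (simp add: abs_mult)
      then have "exp (t * Y x) \<le> 1 + t * Y x + (t * Y x)\<^sup>2" using tb1 by (intro exp_le_quadratic) simp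
      also have "(t * Y x)\<^sup>2 \<le> (t * b)\<^sup>2"
        using \<open>\<bar>t * Y x\<bar> \<le> t * b\<close> t b by (simp flip: abs_le_square_iff)
      finally show ?thesis by (simp add: algebra_simps power2_eq_square)
    qed
    have "expect (\<phi> a) (\<lambda>x. exp (t * Y x)) \<le> expect (\<phi> a) (\<lambda>x. 1 + t * (Y x + t * b\<^sup>2))"
      by (intro expect_mono fin pt)
    also have "\<dots> = 1 + t * (expect (\<phi> a) Y + t * b\<^sup>2)"
      by (simp add: expect_add fin)
    also have "\<dots> \<le> 1"
      using tb(2) \<eta>[of a] t by (simp add: mult_nonneg_nonpos)
    finally show ?thesis .
  qed
  moreover have "min 1 \<eta> / b\<^sup>2 > 0" using \<eta>0 b by simp
  ultimately show ?thesis by blast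
qed

text \<open>The sum over all prefixes is a union bound over the random number of blocks that meet a
  window.\<close>

definition prefix_exp :: "('b \<Rightarrow> real) \<Rightarrow> 'b list \<Rightarrow> real" where
  "prefix_exp Y ws = (\<Sum>m\<le>length ws. exp (\<Sum>w\<leftarrow>take m ws. Y w))"

lemma prefix_exp_Nil [simp]: "prefix_exp Y [] = 1"
  by (simp add: prefix_exp_def)

lemma prefix_exp_Cons [simp]: "prefix_exp Y (x # ws) = 1 + exp (Y x) * prefix_exp Y ws"
  by (simp add: prefix_exp_def sum.atMost_Suc_shift exp_add sum_distrib_left del: sum.atMost_Suc)

lemma prefix_exp_nonneg: "prefix_exp Y ws \<ge> 0"
  by (simp add: prefix_exp_def sum_nonneg)

lemma prefix_exp_ge: "m \<le> length ws \<Longrightarrow> exp (\<Sum>w\<leftarrow>take m ws. Y w) \<le> prefix_exp Y ws"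
  unfolding prefix_exp_def by (intro member_le_sum[of m]) auto

text \<open>By independence the recursion for \<open>prefix_exp\<close> passes to means, where the
  factor in front is at most 1; each letter therefore adds at most 1.\<close>

lemma expect_prefix_exp:
  assumes \<phi>: "random_substitution \<phi>" and "\<And>a. expect (\<phi> a) (\<lambda>x. exp (Y x)) \<le> 1"
  shows "expect (subst_pieces \<phi> u) (prefix_exp Y) \<le> real (length u) + 1"
proof (induction u)
  case (Cons a u)
  have "expect (subst_pieces \<phi> (a # u)) (prefix_exp Y) =
      1 + expect (\<phi> a) (\<lambda>x. exp (Y x)) * expect (subst_pieces \<phi> u) (prefix_exp Y)"
    unfolding expect_subst_pieces_Cons[OF \<phi>]
    by (simp add: expect_add finite_subst_pieces \<phi> random_substitutionD)
  also have "\<dots> \<le> 1 + 1 * (real (length u) + 1)"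
    using assms(2) Cons by (intro add_left_mono mult_mono) (auto intro!: expect_nonneg prefix_exp_nonneg)
  finally show ?case by simp
qed simp

lemma length_concat_ge: "[] \<notin> set ws \<Longrightarrow> length ws \<le> length (concat ws)"
proof (induction ws)
  case (Cons w ws)
  then show ?case by (cases w) auto
qed simp

text \<open>\<open>m\<close> is the least number of blocks that reach the end of the window.
  Minimality bounds the excess on the right by one block; on the left it is \<open>k\<close>, less
  than the first block.\<close>

lemma window_covered_by_blocks:
  assumes ws: "\<And>w. w \<in> set ws \<Longrightarrow> w \<noteq> [] \<and> length w \<le> K"
    and "length ws = d" "k < length (hd ws)" "d > 0" "v \<noteq> []"
  defines "U \<equiv> take d (drop k (concat ws))"
  obtains m where "m \<le> d" "d \<le> length (concat (take m ws))" "length (concat (take m ws)) \<le> d + 2 * K"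
    "occ U v \<le> occ (concat (take m ws)) v"
    "occ (concat (take m ws)) v \<le> occ U v + 2 * K + 2 * length v"
proof -
  obtain w ws' where ws': "ws = w # ws'" using assms by (cases ws) auto
  have kK: "k < K" using ws[of w] assms(3) by (auto simp: ws')
  \<comment> \<open>The first block has at least \<open>k + 1\<close> letters and each of the other
    \<open>d - 1\<close> at least one, so \<open>d\<close> blocks are enough.\<close>
  have "length ws' \<le> length (concat ws')" using ws by (intro length_concat_ge) (auto simp: ws')
  then have total: "k + d \<le> length (concat (take d ws))"
    using assms(2,3) by (auto simp: ws')
  define m where "m = (LEAST m. k + d \<le> length (concat (take m ws)))"
  define X where "X = concat (take m ws)"
  have m: "k + d \<le> length X" "m \<le> d"
    using LeastI[of "\<lambda>m. k + d \<le> length (concat (take m ws))", OF total] Least_le[of "\<lambda>m. k + d \<le> length (concat (take m ws))", OF total]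
    by (auto simp: m_def X_def)
  then obtain m' where m': "m = Suc m'" using \<open>d > 0\<close> by (cases m) (auto simp: X_def)
  have "length (concat (take m' ws)) < k + d"
    using not_less_Least[of m' "\<lambda>m. k + d \<le> length (concat (take m ws))"] m' by (auto simp: m_def)
  moreover have "X = concat (take m' ws) @ ws ! m'"
    using m m' assms(2) by (simp add: X_def take_Suc_conv_app_nth)
  moreover have "length (ws ! m') \<le> K" using ws m m' assms(2) by simp
  ultimately have XK: "length X \<le> k + d + K" by simp
  have "concat ws = X @ concat (drop m ws)"
    unfolding X_def concat_append[symmetric] by simp
  then have U: "U = take d (drop k X)" using m by (simp add: U_def)
  define P where "P = take k X"
  define Q where "Q = drop (k + d) X"
  have "X = take k X @ take d (drop k X) @ drop d (drop k X)" by (simp only: append_take_drop_id)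
  also have "drop d (drop k X) = Q" by (simp add: Q_def add.commute)
  finally have X: "X = P @ U @ Q" unfolding U P_def .
  have PQ: "length P = k" "length Q \<le> K" using m XK by (simp_all add: P_def Q_def)
  show thesis
  proof (rule that[of m])
    show "occ U v \<le> occ (concat (take m ws)) v"
      unfolding X_def[symmetric] unfolding X
      using occ_append_ge[OF \<open>v \<noteq> []\<close>, of P "U @ Q"] occ_append_ge[OF \<open>v \<noteq> []\<close>, of U Q] by simp
    show "occ (concat (take m ws)) v \<le> occ U v + 2 * K + 2 * length v"
      unfolding X_def[symmetric] unfolding X
      using occ_append_le[OF \<open>v \<noteq> []\<close>, of P "U @ Q"] occ_append_le[OF \<open>v \<noteq> []\<close>, of U Q]
        occ_le_length[OF \<open>v \<noteq> []\<close>, of P] occ_le_length[OF \<open>v \<noteq> []\<close>, of Q] PQ kK by simp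
  qed (use m XK kK in \<open>auto simp: X_def\<close>)
qed

lemma sum_list_minus_mult_length:
  "(\<Sum>w\<leftarrow>xs. f w - c * real (length w)) = (\<Sum>w\<leftarrow>xs. f w) - c * real (length (concat xs))"
  by (induction xs) (auto simp: algebra_simps)

text \<open>Weighting each block by \<open>- c * length w\<close> absorbs the random block lengths,
  so a deviation of the window becomes a sum over blocks up to a bounded error. The error carries
  \<bar>c\<bar> because \<open>c\<close> may be negative.\<close>

lemma window_deviation:
  assumes ws: "\<And>w. w \<in> set ws \<Longrightarrow> w \<noteq> [] \<and> length w \<le> K"
    and "length ws = d" "k < length (hd ws)" "d > 0" "v \<noteq> []"
  defines "U \<equiv> take d (drop k (concat ws))"
  shows "\<exists>m\<le>d. real (occ U v) - c * real d \<le>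
      (\<Sum>w\<leftarrow>take m ws. real (occ w v) + length v - c * length w) + \<bar>c\<bar> * (2 * K)"
    and "\<exists>m\<le>d. c * real d - real (occ U v) \<le>
      (\<Sum>w\<leftarrow>take m ws. c * length w - real (occ w v)) + \<bar>c\<bar> * (2 * K) + 2 * K + 2 * length v"
proof -
  obtain m where m: "m \<le> d" "d \<le> length (concat (take m ws))" "length (concat (take m ws)) \<le> d + 2 * K"
    "occ U v \<le> occ (concat (take m ws)) v"
    "occ (concat (take m ws)) v \<le> occ U v + 2 * K + 2 * length v"
    using window_covered_by_blocks[OF assms(1-5)] unfolding U_def by blast
  let ?X = "concat (take m ws)"
  have "\<bar>c * (real (length ?X) - real d)\<bar> \<le> \<bar>c\<bar> * (2 * K)"
    unfolding abs_mult using m by (intro mult_left_mono) auto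
  then have c: "c * length ?X - c * d \<le> \<bar>c\<bar> * (2 * K)" "c * d - c * length ?X \<le> \<bar>c\<bar> * (2 * K)"
    unfolding right_diff_distrib by linarith+
  have coerce: "real (\<Sum>w\<leftarrow>xs. f w) = (\<Sum>w\<leftarrow>xs. real (f w))" for f :: "'a list \<Rightarrow> nat" and xs
    by (induction xs) auto
  have "real (occ ?X v) \<le> real (\<Sum>w\<leftarrow>take m ws. occ w v + length v)"
    using occ_concat_le[OF \<open>v \<noteq> []\<close>, of "take m ws"] by (rule of_nat_mono)
  then have "real (occ ?X v) \<le> (\<Sum>w\<leftarrow>take m ws. real (occ w v) + length v)"
    unfolding coerce of_nat_add .
  then have "real (occ U v) - c * d \<le> (\<Sum>w\<leftarrow>take m ws. real (occ w v) + length v - c * length w) + \<bar>c\<bar> * (2 * K)"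
    unfolding sum_list_minus_mult_length using m(4) c by linarith
  then show "\<exists>m\<le>d. real (occ U v) - c * real d \<le>
      (\<Sum>w\<leftarrow>take m ws. real (occ w v) + length v - c * length w) + \<bar>c\<bar> * (2 * K)"
    using m(1) by blast
  have "(\<Sum>w\<leftarrow>take m ws. real (occ w v)) \<le> real (occ ?X v)"
    using of_nat_mono[OF occ_concat_ge[OF \<open>v \<noteq> []\<close>, of "take m ws"], where 'a = real]
    unfolding coerce .
  moreover have "(\<Sum>w\<leftarrow>xs. c * real (length w) - real (occ w v)) =
      c * real (length (concat xs)) - (\<Sum>w\<leftarrow>xs. real (occ w v))" for xs :: "'a list list"
    by (induction xs) (auto simp: algebra_simps)
  moreover have "real (occ ?X v) \<le> real (occ U v) + 2 * K + 2 * length v"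
    using m(5) by linarith
  ultimately have "c * real d - real (occ U v) \<le>
      (\<Sum>w\<leftarrow>take m ws. c * length w - real (occ w v)) + \<bar>c\<bar> * (2 * K) + 2 * K + 2 * length v"
    using c by simp
  then show "\<exists>m\<le>d. c * real d - real (occ U v) \<le>
      (\<Sum>w\<leftarrow>take m ws. c * length w - real (occ w v)) + \<bar>c\<bar> * (2 * K) + 2 * K + 2 * length v"
    using m(1) by blast
qed

section \<open>Deviation bounds for the Perron-Frobenius vector\<close>

context primitive_expanding
begin

lemma transfer_pow_0:
  assumes "u \<in> legal_words \<theta> l"
  shows "transfer (pow 0) l g u = g u"
proof -
  obtain a u' where u: "u = a # u'" using legal_nonempty[OF assms] by (cases u) auto
  have "(\<lambda>a. return_pmf [a]) = pow 0" by (simp add: subst_power_0 fun_eq_iff)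
  then have "subst_word (pow 0) u' = return_pmf u'" using subst_word_return by metis
  then show ?thesis
    using legal_length[OF assms] by (simp add: u transfer_Cons[OF subst_pow] subst_power_0 window_sum_def)
qed

lemma PF_vector_transfer:
  assumes "l > 0"
  shows "(\<Sum>j\<in>legal_words \<theta> l. PF_vector \<theta> l j * transfer (pow n) l g j) =
    PF_eigenvalue (legal_words \<theta> l) (induced_matrix \<theta> l) ^ n * (\<Sum>j\<in>legal_words \<theta> l. PF_vector \<theta> l j * g j)"
proof (induction n arbitrary: g)
  case 0
  then show ?case by (simp add: transfer_pow_0 cong: sum.cong)
next
  case (Suc n)
  let ?I = "legal_words \<theta> l" and ?R = "PF_vector \<theta> l"
  let ?\<rho> = "PF_eigenvalue ?I (induced_matrix \<theta> l)"
  have ev: "(\<Sum>j\<in>?I. induced_matrix \<theta> l i j * ?R j) = ?\<rho> * ?R i" if "i \<in> ?I" for i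
    using is_PF_vector_PF_vector(1)[OF assms] that by (simp add: is_PF_vector_def)
  have "(\<Sum>j\<in>?I. ?R j * transfer (pow (Suc n)) l g j) =
      (\<Sum>j\<in>?I. ?R j * transfer (pow (Suc 0)) l (transfer (pow n) l g) j)"
    using transfer_power_add[OF subst legal_length legal_nonempty, where m = "Suc 0" and n = n]
    by (intro sum.cong refl) simp
  also have "\<dots> = (\<Sum>j\<in>?I. \<Sum>i\<in>?I. ?R j * (transfer (pow n) l g i * induced_matrix \<theta> l i j))"
    by (intro sum.cong refl, subst transfer_expand) (simp_all add: sum_distrib_left)
  also have "\<dots> = (\<Sum>i\<in>?I. transfer (pow n) l g i * (\<Sum>j\<in>?I. induced_matrix \<theta> l i j * ?R j))"
    by (subst sum.swap) (simp add: sum_distrib_left mult_ac)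
  also have "\<dots> = ?\<rho> * (\<Sum>i\<in>?I. ?R i * transfer (pow n) l g i)"
    unfolding sum_distrib_left[of ?\<rho>] by (intro sum.cong refl) (simp add: ev)
  finally show ?case by (simp add: Suc)
qed

lemma PF_vector_pos: "l > 0 \<Longrightarrow> u \<in> legal_words \<theta> l \<Longrightarrow> PF_vector \<theta> l u > 0"
  using is_PF_vector_PF_vector(1) by (auto simp: is_PF_vector_def)

lemma sum_PF_vector: "l > 0 \<Longrightarrow> (\<Sum>u\<in>legal_words \<theta> l. PF_vector \<theta> l u) = 1"
proof -
  assume l: "l > 0"
  have "(\<Sum>u\<in>legal_words \<theta> l. PF_vector \<theta> l u) = (\<Sum>u\<in>legal_words \<theta> l. \<bar>PF_vector \<theta> l u\<bar>)"
    using PF_vector_pos[OF l] by (intro sum.cong) (auto simp: abs_of_pos)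
  then show ?thesis using is_PF_vector_PF_vector(1)[OF l] by (simp add: is_PF_vector_def)
qed

text \<open>Tested against the constant function 1, whose transfer is a mean length and hence at
  least 1.\<close>

lemma PF_eigenvalue_ge_1:
  assumes l: "l > 0"
  shows "PF_eigenvalue (legal_words \<theta> l) (induced_matrix \<theta> l) \<ge> 1"
proof -
  have "(\<Sum>j\<in>legal_words \<theta> l. PF_vector \<theta> l j * 1) \<le>
      (\<Sum>j\<in>legal_words \<theta> l. PF_vector \<theta> l j * transfer (pow (Suc 0)) l (\<lambda>_. 1) j)"
  proof (intro sum_mono mult_left_mono)
    fix j assume j: "j \<in> legal_words \<theta> l"
    obtain a u where "j = a # u" using legal_nonempty[OF j] by (cases j) auto
    then show "1 \<le> transfer (pow (Suc 0)) l (\<lambda>_. 1) j" using len_ge_1 transfer_one by metis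
  qed (use PF_vector_pos[OF l] in \<open>auto intro: less_imp_le\<close>)
  then show ?thesis unfolding PF_vector_transfer[OF l] using sum_PF_vector[OF l] by simp
qed

text \<open>For nonnegative \<open>g\<close>, multiplying its mean by \<rho> ^ n \<ge> 1 only
  enlarges it, and the result is an average of transferred values. A bound for each starting word
  thus bounds the mean itself.\<close>

lemma PF_vector_sum_le:
  assumes l: "l > 0" and g: "\<And>u. g u \<ge> 0"
    and bound: "\<And>u. u \<in> legal_words \<theta> l \<Longrightarrow> transfer (pow n) l g u \<le> c"
  shows "(\<Sum>u\<in>legal_words \<theta> l. PF_vector \<theta> l u * g u) \<le> c"
proof -
  let ?I = "legal_words \<theta> l" and ?R = "PF_vector \<theta> l"
  let ?S = "\<Sum>u\<in>?I. ?R u * g u" and ?\<rho> = "PF_eigenvalue (legal_words \<theta> l) (induced_matrix \<theta> l)"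
  have "?S \<ge> 0" using PF_vector_pos[OF l] g by (intro sum_nonneg) (simp add: less_imp_le)
  moreover have "?\<rho> ^ n \<ge> 1" using PF_eigenvalue_ge_1[OF l] by (rule one_le_power)
  ultimately have "1 * ?S \<le> ?\<rho> ^ n * ?S" by (intro mult_right_mono)
  also have "\<dots> = (\<Sum>j\<in>?I. ?R j * transfer (pow n) l g j)"
    by (rule PF_vector_transfer[OF l, symmetric])
  also have "\<dots> \<le> (\<Sum>j\<in>?I. ?R j * c)"
    using PF_vector_pos[OF l] by (intro sum_mono mult_left_mono bound) (auto intro: less_imp_le)
  also have "\<dots> = c" using sum_PF_vector[OF l] by (simp flip: sum_distrib_right)
  finally show ?thesis by simp
qed

text \<open>Of the deviation \<open>2 * \<epsilon>\<close>, one \<epsilon> gives the block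
  observables negative means; the other leaves a margin \<open>\<epsilon> * d\<close> for the
  exponential bound.\<close>

lemma PF_vector_deviation:
  assumes v: "v \<in> legal_words \<theta> l" and "\<epsilon> > 0"
  shows "\<exists>C t. C \<ge> 0 \<and> t > 0 \<and> (\<forall>d>0.
    (\<Sum>u\<in>{u \<in> legal_words \<theta> d. \<bar>real (occ u v) / d - PF_vector \<theta> l v\<bar> > 2 * \<epsilon>}. PF_vector \<theta> d u)
      \<le> C * (real d + 1) * exp (- t * d))"
proof -
  let ?R = "PF_vector \<theta> l v"
  note v_ne = legal_nonempty[OF v]
  have lv: "length v = l" by (rule legal_length[OF v])
  obtain n where n: "\<And>a. expect (pow n a) (\<lambda>x. real (occ x v)) + l < (?R + \<epsilon>) * len n a"
     "\<And>a. (?R - \<epsilon>) * len n a < expect (pow n a) (\<lambda>x. real (occ x v))"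
    using expected_drift[OF assms] by blast
  define Y where "Y = (\<lambda>w. real (occ w v) + length v - (?R + \<epsilon>) * length w)"
  define Z where "Z = (\<lambda>w. (?R - \<epsilon>) * length w - real (occ w v))"
  have "expect (pow n a) Y < 0" for a
    using n(1)[of a] by (simp add: Y_def expect_diff expect_add finite_pow len_def lv)
  then obtain t1 where t1: "t1 > 0" "\<And>t a. 0 < t \<Longrightarrow> t \<le> t1 \<Longrightarrow> expect (pow n a) (\<lambda>x. exp (t * Y x)) \<le> 1"
    using exponential_moment_le_1[of "pow n" Y] finite_pow by blast
  have "expect (pow n a) Z < 0" for a
    using n(2)[of a] by (simp add: Z_def expect_diff finite_pow len_def)
  then obtain t2 where t2: "t2 > 0" "\<And>t a. 0 < t \<Longrightarrow> t \<le> t2 \<Longrightarrow> expect (pow n a) (\<lambda>x. exp (t * Z x)) \<le> 1"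
    using exponential_moment_le_1[of "pow n" Z] finite_pow by blast
  define t where "t = min t1 t2"
  have t: "t > 0" using t1(1) t2(1) by (simp add: t_def)
  define K where "K = Max (length ` (\<Union>a. set_pmf (pow n a)))"
  have K: "length w \<le> K" if "w \<in> set_pmf (pow n a)" for w a
    unfolding K_def using that finite_pow by (intro Max_ge) auto
  \<comment> \<open>Collects the boundary errors of both parts of
    \<open>window_deviation\<close>.\<close>
  define c where "c = \<bar>?R + \<epsilon>\<bar> * (2 * K) + \<bar>?R - \<epsilon>\<bar> * (2 * K) + 2 * K + 2 * l"
  have "(\<Sum>u\<in>{u \<in> legal_words \<theta> d. \<bar>real (occ u v) / d - ?R\<bar> > 2 * \<epsilon>}. PF_vector \<theta> d u)
      \<le> (2 * K * exp (t * c)) * (real d + 1) * exp (- (t * \<epsilon>) * d)" if d: "d > 0" for d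
  proof -
    define B where "B = {u. \<bar>real (occ u v) / d - ?R\<bar> > 2 * \<epsilon>}"
    let ?E = "exp (t * (c - \<epsilon> * d))"
    let ?F = "\<lambda>ws. prefix_exp (\<lambda>w. t * Y w) ws + prefix_exp (\<lambda>w. t * Z w) ws"
    \<comment> \<open>At most \<open>K\<close> starting positions in the first block, two signs of
      the deviation, and mean at most \<open>d + 1\<close> for each sum over prefixes.\<close>
    have "transfer (pow n) d (indicator B) u \<le> 2 * K * exp (t * c) * (real d + 1) * exp (- (t * \<epsilon>) * d)"
      if u: "u \<in> legal_words \<theta> d" for u
    proof -
      have pt: "window_sum d (indicator B) (hd ws) (concat (tl ws)) \<le> K * (?E * ?F ws)"
        if ws: "ws \<in> set_pmf (subst_pieces (pow n) u)" for ws
      proof -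
        have la: "list_all2 (\<lambda>w a. w \<in> set_pmf (pow n a)) ws u" using ws by (simp add: set_subst_pieces)
        then have len: "length ws = d" using legal_length[OF u] by (simp add: list_all2_lengthD)
        have bl: "w \<noteq> [] \<and> length w \<le> K" if "w \<in> set ws" for w
          using la that K random_substitutionD(2)[OF subst_pow]
          by (metis in_set_conv_nth list_all2_conv_all_nth)
        have "hd ws \<in> set ws" using len d by (cases ws) auto
        have cw: "hd ws @ concat (tl ws) = concat ws" using len d by (cases ws) auto
        have "indicator B (take d (drop k (concat ws))) \<le> ?E * ?F ws" if k: "k < length (hd ws)" for k
        proof (cases "take d (drop k (concat ws)) \<in> B")
          case True
          let ?U = "take d (drop k (concat ws))"
          have "2 * \<epsilon> < real (occ ?U v) / d - ?R \<or> 2 * \<epsilon> < ?R - real (occ ?U v) / d"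
            using True by (auto simp: B_def abs_if split: if_splits)
          \<comment> \<open>\<open>Y\<close> is large when there are too many occurrences,
            \<open>Z\<close> when there are too few.\<close>
          then have "\<exists>W\<in>{Y, Z}. \<exists>m\<le>d. \<epsilon> * d \<le> (\<Sum>w\<leftarrow>take m ws. W w) + c"
          proof
            assume "2 * \<epsilon> < real (occ ?U v) / d - ?R"
            then have "(?R + 2 * \<epsilon>) * d < occ ?U v" using d by (simp add: field_simps)
            then have "\<epsilon> * d \<le> real (occ ?U v) - (?R + \<epsilon>) * d" by (simp add: algebra_simps)
            moreover obtain m where "m \<le> d" "real (occ ?U v) - (?R + \<epsilon>) * d \<le>
              (\<Sum>w\<leftarrow>take m ws. Y w) + \<bar>?R + \<epsilon>\<bar> * (2 * K)"
              using window_deviation(1)[OF bl len k d v_ne, of "?R + \<epsilon>"] by (auto simp: Y_def)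
            moreover have "\<bar>?R + \<epsilon>\<bar> * (2 * K) \<le> c" by (simp add: c_def)
            ultimately have "\<epsilon> * d \<le> (\<Sum>w\<leftarrow>take m ws. Y w) + c" by linarith
            with \<open>m \<le> d\<close> show ?thesis by blast
          next
            assume "2 * \<epsilon> < ?R - real (occ ?U v) / d"
            then have "real (occ ?U v) < (?R - 2 * \<epsilon>) * d" using d by (simp add: field_simps)
            then have "\<epsilon> * d \<le> (?R - \<epsilon>) * d - real (occ ?U v)" by (simp add: algebra_simps)
            moreover obtain m where "m \<le> d" "(?R - \<epsilon>) * d - real (occ ?U v) \<le>
              (\<Sum>w\<leftarrow>take m ws. Z w) + \<bar>?R - \<epsilon>\<bar> * (2 * K) + 2 * K + 2 * length v"
              using window_deviation(2)[OF bl len k d v_ne, of "?R - \<epsilon>"] by (auto simp: Z_def)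
            moreover have "\<bar>?R - \<epsilon>\<bar> * (2 * K) + 2 * K + 2 * length v \<le> c" by (simp add: c_def lv)
            ultimately have "\<epsilon> * d \<le> (\<Sum>w\<leftarrow>take m ws. Z w) + c" by linarith
            with \<open>m \<le> d\<close> show ?thesis by blast
          qed
          then obtain W m where W: "W \<in> {Y, Z}" and m: "m \<le> d" "\<epsilon> * d \<le> (\<Sum>w\<leftarrow>take m ws. W w) + c"
            by blast
          \<comment> \<open>Chernoff's bound in pointwise form: on the bad event the exponential of
            the excess is at least 1.\<close>
          have "1 = ?E * exp (t * (\<epsilon> * d - c))" by (simp flip: exp_add) (simp add: algebra_simps)
          also have "\<dots> \<le> ?E * exp (\<Sum>w\<leftarrow>take m ws. t * W w)"
            unfolding sum_list_const_mult using m t by (intro mult_left_mono) auto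
          also have "\<dots> \<le> ?E * prefix_exp (\<lambda>w. t * W w) ws"
            using m len by (intro mult_left_mono prefix_exp_ge) auto
          also have "\<dots> \<le> ?E * ?F ws"
            using W by (intro mult_left_mono) (auto simp: prefix_exp_nonneg)
          finally show ?thesis using True by simp
        qed (simp add: prefix_exp_nonneg)
        then have "window_sum d (indicator B) (hd ws) (concat (tl ws)) \<le> (\<Sum>k<length (hd ws). ?E * ?F ws)"
          unfolding window_sum_def cw by (intro sum_mono) simp
        also have "\<dots> = length (hd ws) * (?E * ?F ws)" by simp
        also have "\<dots> \<le> K * (?E * ?F ws)"
          using bl[OF \<open>hd ws \<in> set ws\<close>] by (intro mult_right_mono) (auto simp: prefix_exp_nonneg)
        finally show ?thesis .
      qed
      have "transfer (pow n) d (indicator B) u \<le> expect (subst_pieces (pow n) u) (\<lambda>ws. K * (?E * ?F ws))"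
        unfolding transfer_def by (intro expect_mono finite_subst_pieces subst_pow pt)
      also have "\<dots> = K * (?E * (expect (subst_pieces (pow n) u) (prefix_exp (\<lambda>w. t * Y w)) +
          expect (subst_pieces (pow n) u) (prefix_exp (\<lambda>w. t * Z w))))"
        by (simp add: expect_add finite_subst_pieces subst_pow)
      also have "\<dots> \<le> K * (?E * ((real (length u) + 1) + (real (length u) + 1)))"
        using t t1(2) t2(2)
        by (intro mult_left_mono add_mono expect_prefix_exp subst_pow) (auto simp: t_def)
      also have "\<dots> = 2 * K * exp (t * c) * (real d + 1) * exp (- (t * \<epsilon>) * d)"
        using legal_length[OF u] by (simp add: right_diff_distrib exp_diff exp_minus field_simps)
      finally show ?thesis .
    qed
    then have "(\<Sum>u\<in>legal_words \<theta> d. PF_vector \<theta> d u * indicator B u) \<le>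
        2 * K * exp (t * c) * (real d + 1) * exp (- (t * \<epsilon>) * d)"
      by (intro PF_vector_sum_le[where n = n] d) auto
    also have "(\<Sum>u\<in>legal_words \<theta> d. PF_vector \<theta> d u * indicator B u) = (\<Sum>u\<in>legal_words \<theta> d \<inter> B. PF_vector \<theta> d u)"
      unfolding sum.inter_restrict[OF finite_legal] by (intro sum.cong) (auto simp: indicator_def)
    also have "legal_words \<theta> d \<inter> B = {u \<in> legal_words \<theta> d. \<bar>real (occ u v) / d - ?R\<bar> > 2 * \<epsilon>}"
      by (auto simp: B_def)
    finally show ?thesis .
  qed
  moreover have "2 * K * exp (t * c) \<ge> 0" "t * \<epsilon> > 0" using t \<open>\<epsilon> > 0\<close> by auto
  ultimately show ?thesis by blast
qed

end

section \<open>Almost sure convergence\<close>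

lemma window_append:
  "a \<le> m \<Longrightarrow> m \<le> b + 1 \<Longrightarrow> window y a b = window y a (m - 1) @ window y m b"
  using upto_split1[of a m b] by (cases "m = b + 1") (auto simp: window_def)

lemma length_window [simp]: "length (window y a b) = nat (b - a + 1)"
  by (simp add: window_def)

locale frequency_space = primitive_expanding \<theta> + prob_space \<mu>
  for \<theta> :: "'a::finite \<Rightarrow> 'a list pmf" and \<mu> :: "(int \<Rightarrow> 'a) measure" +
  assumes frequency: "frequency_measure \<theta> \<mu>"
begin

section \<open>Events that depend on one window\<close>

lemma space_eq: "space \<mu> = subshift \<theta>"
  using frequency by (simp add: frequency_measure_def)

lemma coordinate_measurable: "{y \<in> space \<mu>. y i = c} \<in> sets \<mu>"
proof -
  have "openin (product_topology (\<lambda>_::int. discrete_topology (UNIV :: 'a set)) UNIV) {x. x i = c}"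
    using openin_continuous_map_preimage[OF continuous_map_product_projection[of i UNIV
        "\<lambda>_. discrete_topology (UNIV :: 'a set)"], of "{c}"] by simp
  then have "openin (subshift_topology \<theta>) {y \<in> space \<mu>. y i = c}"
    unfolding subshift_topology_def openin_subtopology by (auto simp: space_eq)
  then show ?thesis
    using frequency by (auto simp: frequency_measure_def)
qed

lemma window_measurable_eq: "{y \<in> space \<mu>. window y a b = w} \<in> sets \<mu>"
proof (cases "length w = nat (b - a + 1)")
  case True
  have eq: "window y a b = w \<longleftrightarrow> (\<forall>k\<in>{..<nat (b - a + 1)}. y (a + int k) = w ! k)" for y
    using True by (auto simp: list_eq_iff_nth_eq window_def)
  have "{y \<in> space \<mu>. \<forall>k\<in>{..<nat (b - a + 1)}. y (a + int k) = w ! k} \<in> sets \<mu>"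
    by (intro sets.sets_Collect_finite_All coordinate_measurable) auto
  then show ?thesis by (simp only: eq)
next
  case False
  then have "{y \<in> space \<mu>. window y a b = w} = {}" by auto
  then show ?thesis by (simp only: sets.empty_sets)
qed

lemma window_legal:
  assumes "y \<in> space \<mu>" "a \<le> b"
  shows "window y a b \<in> legal_words \<theta> (nat (b - a + 1))"
  using assms by (simp add: legal_words_def space_eq subshift_def)

lemma window_in_eq:
  assumes "a \<le> b"
  shows "{y \<in> space \<mu>. window y a b \<in> B} =
    (\<Union>u\<in>legal_words \<theta> (nat (b - a + 1)) \<inter> B. {y \<in> space \<mu>. window y a b = u})"
  using window_legal[OF _ assms] by auto

lemma window_measurable:
  assumes "a \<le> b"
  shows "{y \<in> space \<mu>. window y a b \<in> B} \<in> sets \<mu>"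
  unfolding window_in_eq[OF assms] using finite_legal
  by (intro sets.finite_UN window_measurable_eq) auto

lemma prob_window_centred:
  assumes "a \<le> 0" "0 \<le> b"
  shows "prob {y \<in> space \<mu>. window y a b \<in> B} =
    (\<Sum>u\<in>legal_words \<theta> (nat (b - a + 1)) \<inter> B. PF_vector \<theta> (nat (b - a + 1)) u)"
proof -
  have "a \<le> b" using assms by simp
  have "prob {y \<in> space \<mu>. window y a b \<in> B} =
      (\<Sum>u\<in>legal_words \<theta> (nat (b - a + 1)) \<inter> B. prob {y \<in> space \<mu>. window y a b = u})"
    unfolding window_in_eq[OF \<open>a \<le> b\<close>] using finite_legal window_measurable_eq
    by (intro finite_measure_finite_Union) (auto simp: disjoint_family_on_def)
  also have "\<dots> = (\<Sum>u\<in>legal_words \<theta> (nat (b - a + 1)) \<inter> B. PF_vector \<theta> (nat (b - a + 1)) u)"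
    using frequency assms
    by (intro sum.cong refl) (auto simp: frequency_measure_def space_eq cylinder_def)
  finally show ?thesis .
qed

text \<open>Only cylinders around the origin are prescribed; a window away from the origin is compared
  with a translate of itself by enlarging both to windows that contain \<open>0\<close>.\<close>

lemma prob_window:
  assumes "a \<le> b"
  shows "prob {y \<in> space \<mu>. window y a b \<in> B} =
    (\<Sum>u\<in>legal_words \<theta> (nat (b - a + 1)) \<inter> B. PF_vector \<theta> (nat (b - a + 1)) u)"
proof -
  consider "a \<le> 0" "0 \<le> b" | "a > 0" | "b < 0" by linarith
  then show ?thesis
  proof cases
    case 1
    then show ?thesis by (rule prob_window_centred)
  next
    case 2
    let ?B = "{w. drop (nat a) w \<in> B}"
    have shift: "drop (nat a) (window y (- a) (b - a)) = window y 0 (b - a)" for y :: "int \<Rightarrow> 'a"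
      using window_append[of "- a" 0 "b - a" y] 2 assms by simp
    have "window y a b = drop (nat a) (window y 0 b)" for y :: "int \<Rightarrow> 'a"
      using window_append[of 0 a b y] 2 assms by simp
    then have "prob {y \<in> space \<mu>. window y a b \<in> B} = prob {y \<in> space \<mu>. window y 0 b \<in> ?B}"
      by simp
    also have "\<dots> = prob {y \<in> space \<mu>. window y (- a) (b - a) \<in> ?B}"
      using 2 assms by (subst (1 2) prob_window_centred) auto
    also have "\<dots> = prob {y \<in> space \<mu>. window y 0 (b - a) \<in> B}"
      by (simp only: mem_Collect_eq shift)
    also have "\<dots> = (\<Sum>u\<in>legal_words \<theta> (nat (b - a + 1)) \<inter> B. PF_vector \<theta> (nat (b - a + 1)) u)"
      using assms by (subst prob_window_centred) simp_all
    finally show ?thesis .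
  next
    case 3
    let ?B = "{w. take (nat (b - a + 1)) w \<in> B}"
    have shift: "take (nat (b - a + 1)) (window y (a - b) (- b)) = window y (a - b) 0" for y :: "int \<Rightarrow> 'a"
      using window_append[of "a - b" 1 "- b" y] 3 assms by simp
    have "window y a b = take (nat (b - a + 1)) (window y a 0)" for y :: "int \<Rightarrow> 'a"
      using window_append[of a "b + 1" 0 y] 3 assms by simp
    then have "prob {y \<in> space \<mu>. window y a b \<in> B} = prob {y \<in> space \<mu>. window y a 0 \<in> ?B}"
      by simp
    also have "\<dots> = prob {y \<in> space \<mu>. window y (a - b) (- b) \<in> ?B}"
      using 3 assms by (subst (1 2) prob_window_centred) auto
    also have "\<dots> = prob {y \<in> space \<mu>. window y (a - b) 0 \<in> B}"
      by (simp only: mem_Collect_eq shift)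
    also have "\<dots> = (\<Sum>u\<in>legal_words \<theta> (nat (b - a + 1)) \<inter> B. PF_vector \<theta> (nat (b - a + 1)) u)"
      using assms by (subst prob_window_centred) simp_all
    finally show ?thesis .
  qed
qed

lemma AE_eventually_close:
  fixes a b :: "nat \<Rightarrow> int"
  assumes v: "v \<in> legal_words \<theta> l" and ab: "\<And>n. a n \<le> b n"
    and mono: "strict_mono (\<lambda>n. b n - a n + 1)" and "\<epsilon> > 0"
  shows "AE y in \<mu>. \<forall>\<^sub>F n in sequentially.
    \<bar>real (occ (window y (a n) (b n)) v) / real_of_int (b n - a n + 1) - PF_vector \<theta> l v\<bar> \<le> 2 * \<epsilon>"
proof -
  let ?R = "PF_vector \<theta> l v"
  define d where "d n = nat (b n - a n + 1)" for n
  have d: "d n > 0" "real (d n) = real_of_int (b n - a n + 1)" for n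
    using ab[of n] by (auto simp: d_def)
  have "strict_mono d"
    using mono ab unfolding strict_mono_def d_def by (smt (verit) zless_nat_conj)
  then have inj: "inj d" by (rule strict_mono_imp_inj_on)
  obtain C t where C: "C \<ge> 0" and t: "t > 0" and bound: "\<And>d. d > 0 \<Longrightarrow>
    (\<Sum>u\<in>{u \<in> legal_words \<theta> d. \<bar>real (occ u v) / d - ?R\<bar> > 2 * \<epsilon>}. PF_vector \<theta> d u)
      \<le> C * (real d + 1) * exp (- t * d)"
    using PF_vector_deviation[OF v \<open>\<epsilon> > 0\<close>] by blast
  define B where "B n = {u. \<bar>real (occ u v) / d n - ?R\<bar> > 2 * \<epsilon>}" for n
  define A where "A n = {y \<in> space \<mu>. window y (a n) (b n) \<in> B n}" for n
  have A: "A n \<in> sets \<mu>" for n unfolding A_def by (rule window_measurable[OF ab])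
  have prob_A: "prob (A n) \<le> C * (real (d n) + 1) * exp (- t * d n)" for n
  proof -
    have "legal_words \<theta> (d n) \<inter> B n = {u \<in> legal_words \<theta> (d n). \<bar>real (occ u v) / d n - ?R\<bar> > 2 * \<epsilon>}"
      by (auto simp: B_def)
    then show ?thesis
      unfolding A_def prob_window[OF ab] d_def[symmetric] using bound[OF d(1)] by simp
  qed
  \<comment> \<open>The differentiated geometric series at \<open>exp (- t) < 1\<close>.\<close>
  have "summable (\<lambda>n. real (Suc n) * exp (- t) ^ n)"
    using t by (intro sums_summable[OF geometric_deriv_sums]) simp
  then have "summable (\<lambda>n. C * (real (Suc n) * exp (- t) ^ n))" by (rule summable_mult)
  then have "summable (\<lambda>n. C * (real n + 1) * exp (- t * n))"
    by (simp add: exp_of_nat_mult[symmetric] mult_ac add.commute)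
  \<comment> \<open>Strictly increasing lengths use each value of \<open>d\<close> at most once, so
    the series along \<open>d\<close> is a subseries.\<close>
  then have "summable ((\<lambda>n. C * (real n + 1) * exp (- t * n)) \<circ> d)"
    using C inj by (intro summable_reindex) auto
  then have "summable (\<lambda>n. prob (A n))"
  proof (rule summable_comparison_test'[where N = 0])
    show "norm (prob (A n)) \<le> ((\<lambda>n. C * (real n + 1) * exp (- t * n)) \<circ> d) n" for n
      unfolding o_def real_norm_def abs_of_nonneg[OF measure_nonneg] by (rule prob_A)
  qed
  then have "AE y in \<mu>. \<forall>\<^sub>F n in sequentially. y \<in> space \<mu> - A n"
    using A by (intro borel_cantelli_AE1) (auto simp: emeasure_eq_measure)
  then show ?thesis
  proof (rule AE_mp, intro AE_I2 impI)
    fix y assume "\<forall>\<^sub>F n in sequentially. y \<in> space \<mu> - A n"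
    then show "\<forall>\<^sub>F n in sequentially. \<bar>real (occ (window y (a n) (b n)) v) / real_of_int (b n - a n + 1) - ?R\<bar> \<le> 2 * \<epsilon>"
      by eventually_elim (auto simp: A_def B_def d(2))
  qed
qed

text \<open>The exceptional null set depends on \<epsilon>; countably many values
  \<open>1 / Suc j\<close> suffice for the limit and keep the union null.\<close>

lemma AE_frequency_tendsto:
  fixes a b :: "nat \<Rightarrow> int"
  assumes "v \<in> legal_words \<theta> l" "\<And>n. a n \<le> b n" "strict_mono (\<lambda>n. b n - a n + 1)"
  shows "AE y in \<mu>. (\<lambda>n. real (occ (window y (a n) (b n)) v) / real_of_int (b n - a n + 1))
           \<longlonglongrightarrow> PF_vector \<theta> l v"
proof -
  have "AE y in \<mu>. \<forall>j::nat. \<forall>\<^sub>F n in sequentially.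
    \<bar>real (occ (window y (a n) (b n)) v) / real_of_int (b n - a n + 1) - PF_vector \<theta> l v\<bar> \<le> 2 * (1 / Suc j)"
    unfolding AE_all_countable by (intro allI AE_eventually_close assms) simp
  then show ?thesis
  proof (rule AE_mp, intro AE_I2 impI)
    fix y
    assume *: "\<forall>j::nat. \<forall>\<^sub>F n in sequentially.
      \<bar>real (occ (window y (a n) (b n)) v) / real_of_int (b n - a n + 1) - PF_vector \<theta> l v\<bar> \<le> 2 * (1 / Suc j)"
    show "(\<lambda>n. real (occ (window y (a n) (b n)) v) / real_of_int (b n - a n + 1)) \<longlonglongrightarrow> PF_vector \<theta> l v"
    proof (rule tendstoI)
      fix e :: real assume "e > 0"
      then obtain j where "inverse (real (Suc j)) < e / 2" using reals_Archimedean[of "e / 2"] by auto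
      then have "2 * (1 / real (Suc j)) < e" by (simp add: inverse_eq_divide)
      then show "\<forall>\<^sub>F n in sequentially. dist (real (occ (window y (a n) (b n)) v) / real_of_int (b n - a n + 1)) (PF_vector \<theta> l v) < e"
        using *[rule_format, of j] by (auto simp: dist_real_def elim!: eventually_mono)
    qed
  qed
qed

end

theorem proposition5p8:
  fixes \<theta> :: "'a::finite \<Rightarrow> 'a list pmf"
    and \<mu> :: "(int \<Rightarrow> 'a) measure"
    and l :: nat
    and v :: "'a list"
    and a b :: "nat \<Rightarrow> int"
  assumes "random_substitution \<theta>"
    and "primitive_subst \<theta>"
    and "expanding_subst \<theta>"
    and "frequency_measure \<theta> \<mu>"
    and "v \<in> legal_words \<theta> l"
    and "\<And>n. a n \<le> b n"
    and "strict_mono (\<lambda>n. b n - a n + 1)"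
  shows "AE y in \<mu>. (\<lambda>n. real (occ (window y (a n) (b n)) v) / real_of_int (b n - a n + 1))
           \<longlonglongrightarrow> PF_vector \<theta> l v"
proof -
  interpret prob_space \<mu> using assms(4) by (simp add: frequency_measure_def)
  interpret frequency_space \<theta> \<mu> by unfold_locales fact+
  show ?thesis by (rule AE_frequency_tendsto) fact+
qed

end
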